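(* Let $k$ be a field, $S=k[x_1,\dots,x_n]$, and let $I\subseteq S$ be a squarefree matroidal ideal or a stable monomial ideal. Then the minimal free resolution of $S/I$ over $S$ has a DGA structure.
   Context: A squarefree matroidal ideal is a squarefree monomial ideal such that the supports of its minimal monomial generators are the bases of a matroid on $\{1,\dots,n\}$. A monomial ideal $I$ is stable if for every monomial $u\in I$ and every $i<\max(u)$, where $\max(u)$ is the largest index of a variable dividing $u$, the monomial $x_iu/x_{\max(u)}$ lies in $I$. A DGA structure on a free resolution $F_\bullet$ of $S/I$ with $F_0=S$ is a chain map $\mu:F_\bullet\otimes_SF_\bullet\to F_\bullet$ (so the Leibniz rule holds) that is associative, graded commutative ($\mu(x\otimes y)=(-1)^{pq}\mu(y\otimes x)$ for $x,y$ homogeneous of degrees $p,q$), and for which $1\in F_0=S$ is a two-sided identity. *)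

theory Defs
  imports "HOL.Modules" "HOL-Library.Poly_Mapping" "HOL-Library.Disjoint_Sets"
begin

text \<open>
  The polynomial ring \<open>S = k[x_1, ..., x_n]\<close> is the type of finitely supported functions from
  exponent vectors to \<open>'k\<close>, with the convolution product. The finite linearly ordered type \<open>'n\<close>
  is the index set \<open>1 < ... < n\<close> of the variables.
\<close>

type_synonym ('n, 'k) mpoly = "('n \<Rightarrow>\<^sub>0 nat) \<Rightarrow>\<^sub>0 'k"

definition monom :: "('n \<Rightarrow>\<^sub>0 nat) \<Rightarrow> ('n, 'k::zero_neq_one) mpoly" where
  "monom a = Poly_Mapping.single a 1"

definition homogeneous :: "int \<Rightarrow> ('n::finite, 'k::zero) mpoly \<Rightarrow> bool" where
  "homogeneous j f \<longleftrightarrow>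
     (\<forall>t\<in>Poly_Mapping.keys f. int (\<Sum>i\<in>UNIV. Poly_Mapping.lookup t i) = j)"

definition ideal_gen :: "'a::comm_ring_1 set \<Rightarrow> 'a set" where
  "ideal_gen = module.span (*)"

definition irrelevant_ideal :: "('n, 'k::comm_ring_1) mpoly set" where
  "irrelevant_ideal = ideal_gen (range (\<lambda>i. monom (Poly_Mapping.single i 1)))"


section \<open>Matroidal and stable ideals\<close>

definition monomial_ideal :: "('n, 'k::comm_ring_1) mpoly set \<Rightarrow> bool" where
  "monomial_ideal I \<longleftrightarrow> (\<exists>A. I = ideal_gen (monom ` A))"

definition squarefree_monomial_ideal :: "('n, 'k::comm_ring_1) mpoly set \<Rightarrow> bool" where
  "squarefree_monomial_ideal I \<longleftrightarrow>
     (\<exists>A. (\<forall>a\<in>A. \<forall>i. Poly_Mapping.lookup a i \<le> 1) \<and> I = ideal_gen (monom ` A))"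

text \<open>The exponent vectors of the minimal monomial generators.\<close>

definition min_gens :: "('n, 'k::comm_ring_1) mpoly set \<Rightarrow> ('n \<Rightarrow>\<^sub>0 nat) set" where
  "min_gens I =
     {a. monom a \<in> I \<and>
         (\<forall>b. monom b \<in> I \<and> (monom b :: ('n, 'k) mpoly) dvd monom a \<longrightarrow> b = a)}"

definition matroid :: "'a set \<Rightarrow> 'a set set \<Rightarrow> bool" where
  "matroid E Ind \<longleftrightarrow>
     finite E \<and> Ind \<subseteq> Pow E \<and> {} \<in> Ind \<and>
     (\<forall>X\<in>Ind. \<forall>Y. Y \<subseteq> X \<longrightarrow> Y \<in> Ind) \<and>
     (\<forall>X\<in>Ind. \<forall>Y\<in>Ind. card X < card Y \<longrightarrow> (\<exists>y\<in>Y - X. insert y X \<in> Ind))"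

definition matroid_bases :: "'a set set \<Rightarrow> 'a set set" where
  "matroid_bases Ind = {X \<in> Ind. \<forall>Y\<in>Ind. X \<subseteq> Y \<longrightarrow> Y = X}"

definition squarefree_matroidal_ideal :: "('n::finite, 'k::comm_ring_1) mpoly set \<Rightarrow> bool" where
  "squarefree_matroidal_ideal I \<longleftrightarrow>
     squarefree_monomial_ideal I \<and>
     (\<exists>Ind. matroid (UNIV :: 'n set) Ind \<and>
            Poly_Mapping.keys ` min_gens I = matroid_bases Ind)"

text \<open>The monomial \<open>1\<close> is divisible by no variable, so the exchange condition excludes it.\<close>

definition stable_monomial_ideal ::
    "('n::{finite,linorder}, 'k::comm_ring_1) mpoly set \<Rightarrow> bool" where
  "stable_monomial_ideal I \<longleftrightarrow>
     monomial_ideal I \<and>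
     (\<forall>a. monom a \<in> I \<and> a \<noteq> 0 \<longrightarrow>
        (let m = Max (Poly_Mapping.keys a) in
          \<forall>i<m. monom (a - Poly_Mapping.single m 1 + Poly_Mapping.single i 1) \<in> I))"


section \<open>Graded minimal free resolutions\<close>

text \<open>
  A complex \<open>F_0 \<leftarrow> F_1 \<leftarrow> ...\<close> of free modules is given by its total module: the type \<open>'m\<close> is
  the direct sum of the \<open>F p = span (B p)\<close>, where \<open>B p\<close> is a finite homogeneous basis of \<open>F_p\<close>
  whose elements have the internal degrees \<open>deg\<close> (standard grading of \<open>S\<close>). In degree 0 the
  basis is the single element \<open>e\<close> of internal degree 0, so \<open>s \<mapsto> s e\<close> identifies \<open>S\<close>
  with \<open>F_0\<close> and \<open>e\<close> with \<open>1\<close>; with this identification, exactness of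
  \<open>F_1 \<rightarrow> F_0 \<rightarrow> S/I \<rightarrow> 0\<close> says that the image of \<open>F_1\<close> in \<open>F_0 = S\<close> is \<open>I\<close>.
\<close>

definition degree_part ::
    "(('n::finite, 'k::comm_ring_1) mpoly \<Rightarrow> 'm::ab_group_add \<Rightarrow> 'm) \<Rightarrow> ('m \<Rightarrow> int) \<Rightarrow>
     'm set \<Rightarrow> int \<Rightarrow> 'm set" where
  "degree_part scale deg C j =
     {\<Sum>c\<in>C. scale (f c) c | f. \<forall>c\<in>C. homogeneous (j - deg c) (f c)}"

locale graded_free_resolution = module scale
  for scale :: "('n::finite, 'k::field) mpoly \<Rightarrow> 'm::ab_group_add \<Rightarrow> 'm" +
  fixes I :: "('n, 'k) mpoly set"
    and B :: "nat \<Rightarrow> 'm set"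
    and deg :: "'m \<Rightarrow> int"
    and d :: "'m \<Rightarrow> 'm"
    and e :: "'m"
  assumes finite_basis: "finite (B p)"
    and disjoint_bases: "disjoint_family B"
    and independent_basis: "independent (\<Union>p. B p)"
    and span_basis: "span (\<Union>p. B p) = UNIV"
    and basis_0: "B 0 = {e}"
    and deg_e: "deg e = 0"
    and d_linear: "module_hom scale scale d"
    and d_0: "x \<in> span (B 0) \<Longrightarrow> d x = 0"
    and d_Suc: "x \<in> span (B (Suc p)) \<Longrightarrow> d x \<in> span (B p)"
    and d_graded: "b \<in> B (Suc p) \<Longrightarrow> d b \<in> degree_part scale deg (B p) (deg b)"
    and exact_0: "d ` span (B 1) = (\<lambda>s. scale s e) ` I"
    and exact_Suc: "d ` span (B (Suc (Suc p))) = {x \<in> span (B (Suc p)). d x = 0}"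
begin

abbreviation F :: "nat \<Rightarrow> 'm set" where
  "F p \<equiv> span (B p)"

end

locale minimal_free_resolution = graded_free_resolution scale I B deg d e
  for scale :: "('n::finite, 'k::field) mpoly \<Rightarrow> 'm::ab_group_add \<Rightarrow> 'm"
    and I B deg d e +
  assumes minimal: "d x \<in> span {scale f y | f y. f \<in> irrelevant_ideal}"


section \<open>DGA structures\<close>

text \<open>
  An \<open>S\<close>-linear map from the tensor product of \<open>F\<close> with itself is an \<open>S\<close>-bilinear map;
  \<open>mu_linear_left\<close>, \<open>mu_linear_right\<close>, \<open>mu_degree\<close> and \<open>leibniz\<close> say that it is a chain map.
\<close>

locale dga_structure = graded_free_resolution scale I B deg d e
  for scale :: "('n::finite, 'k::field) mpoly \<Rightarrow> 'm::ab_group_add \<Rightarrow> 'm"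
    and I B deg d e +
  fixes \<mu> :: "'m \<Rightarrow> 'm \<Rightarrow> 'm"
  assumes mu_linear_left: "module_hom scale scale (\<lambda>x. \<mu> x y)"
    and mu_linear_right: "module_hom scale scale (\<lambda>y. \<mu> x y)"
    and mu_degree: "x \<in> F p \<Longrightarrow> y \<in> F q \<Longrightarrow> \<mu> x y \<in> F (p + q)"
    and leibniz: "x \<in> F p \<Longrightarrow> d (\<mu> x y) = \<mu> (d x) y + scale ((-1) ^ p) (\<mu> x (d y))"
    and assoc: "\<mu> (\<mu> x y) z = \<mu> x (\<mu> y z)"
    and graded_commute: "x \<in> F p \<Longrightarrow> y \<in> F q \<Longrightarrow> \<mu> x y = scale ((-1) ^ (p * q)) (\<mu> y x)"
    and unit_left: "\<mu> e x = x"
    and unit_right: "\<mu> x e = x"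

end

theory Submission
  imports Defs
begin

text \<open>
  Both kinds of ideals have a decomposition: every monomial of \<open>I\<close> is uniquely \<open>u y\<close> with \<open>u\<close> a
  minimal generator and no variable of \<open>y\<close> in a set \<open>st u\<close>, and \<open>st\<close> shrinks along
  \<open>u \<mapsto> g (x\<^sub>i u)\<close> for \<open>i \<in> st u\<close>. For a stable ideal this is the Eliahou--Kervaire decomposition;
  for a matroid \<open>u\<close> is the greedy basis and \<open>st u\<close> consists of the \<open>j\<close> not spanned by the elements
  \<open>\<le> j\<close> of \<open>u\<close>. A free module on symbols \<open>(\<sigma>; u)\<close> with \<open>\<sigma> \<subseteq> st u\<close> then carries a differential and
  a \<open>k\<close>-linear contraction \<open>h\<close> matching \<open>x\<^sub>i (\<sigma>; u)\<close> with \<open>(\<sigma> \<union> {i}; u)\<close> for \<open>i < min \<sigma>\<close>.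

  The product of basis elements is forced to be \<open>a b = h (d a b \<plusminus> a d b)\<close>, which gives the Leibniz
  rule. The associator is a chain map, so by induction it is a cycle on basis elements; it vanishes if
  \<open>h\<close> kills it. This holds because the variables that \<open>h\<close> can act on in the terms of \<open>a b\<close> are among
  those for \<open>a\<close> and those for \<open>b\<close>. Finally, a minimal resolution is unique up to isomorphism.
\<close>

text \<open>A cycle \<open>v\<close> of positive degree with \<open>h v = 0\<close> vanishes, since
  \<open>v = d (h v) + h (d v)\<close>. As \<open>h\<close> is only \<open>k\<close>-linear, what it
  kills must be followed cell by cell: \<open>x^m l\<close> is killed when no variable of
  \<open>m\<close> is active for \<open>l\<close>, and multiplying by \<open>c\<close> preserves
  this if the terms of \<open>l c\<close> have no active variables beyond those of \<open>l\<close>.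
  The obstacle is the product with a generator, which is \<open>h (x^u b)\<close>: running
  \<open>h\<close> uses up variables of \<open>u\<close>, and one has to know that the resulting
  symbols are active only in directions from \<open>st u\<close>. The two classes of ideals need
  different arguments here. In the stable ideal \<open>(x1, x2)^2\<close> the variable
  \<open>x1\<close> stays active when \<open>x1 x2^2\<close> is rewritten as
  \<open>(x1 x2) x2\<close>, so the separation available for matroids fails. For the basis
  \<open>{1, 3}\<close> of the uniform matroid of rank 2 on three elements, 1 is not in
  \<open>st u\<close> although 3 is in the support, so the initial-segment property of stable ideals
  fails.\<close>

declare One_nat_def [simp del]

abbreviation lookup where "lookup \<equiv> Poly_Mapping.lookup"
abbreviation keys where "keys \<equiv> Poly_Mapping.keys"
abbreviation single where "single \<equiv> Poly_Mapping.single"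

section \<open>Free modules over the polynomial ring\<close>

definition fscale :: "'a::comm_ring_1 \<Rightarrow> ('l \<Rightarrow>\<^sub>0 'a) \<Rightarrow> 'l \<Rightarrow>\<^sub>0 'a" where
  "fscale f v = Poly_Mapping.map ((*) f) v"

lemma lookup_fscale [simp]:
  "lookup (fscale f v) l = f * lookup v l"
  unfolding fscale_def by transfer (simp add: when_def)

interpretation free: module "fscale :: 'a::comm_ring_1 \<Rightarrow> ('l \<Rightarrow>\<^sub>0 'a) \<Rightarrow> _"
  by unfold_locales
    (auto intro!: poly_mapping_eqI simp: lookup_add algebra_simps)

lemma fscale_single: "fscale f (single l g) = single l (f * g)"
  by (rule poly_mapping_eqI) (simp add: lookup_single when_def)

abbreviation unit_vec :: "'l \<Rightarrow> 'l \<Rightarrow>\<^sub>0 'a::comm_ring_1" where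
  "unit_vec l \<equiv> single l 1"

lemma keys_monom [simp]: "keys (monom m :: ('n, 'k::zero_neq_one) mpoly) = {m}"
  by (simp add: monom_def)

lemma monom_mult: "monom a * monom b = (monom (a + b) :: ('n, 'k::comm_ring_1) mpoly)"
  by (simp add: monom_def mult_single)

lemma monom_0 [simp]: "monom 0 = (1 :: ('n, 'k::comm_ring_1) mpoly)"
  by (simp add: monom_def)

context module
begin

definition lin_ext :: "('l \<Rightarrow> 'b) \<Rightarrow> ('l \<Rightarrow>\<^sub>0 'a) \<Rightarrow> 'b" where
  "lin_ext f v = (\<Sum>l\<in>keys v. lookup v l *s f l)"

lemma lin_ext_superset:
  assumes "finite A" "keys v \<subseteq> A"
  shows "lin_ext f v = (\<Sum>l\<in>A. lookup v l *s f l)"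
  unfolding lin_ext_def using assms
  by (intro sum.mono_neutral_left) (auto simp: in_keys_iff)

lemma lin_ext_add: "lin_ext f (v + w) = lin_ext f v + lin_ext f w"
proof -
  let ?A = "keys v \<union> keys w"
  have "keys (v + w) \<subseteq> ?A" by (rule keys_add)
  then show ?thesis
    by (simp add: lin_ext_superset[of ?A] lookup_add scale_left_distrib sum.distrib)
qed

lemma lin_ext_fscale: "lin_ext f (fscale a v) = a *s lin_ext f v"
proof -
  have "keys (fscale a v) \<subseteq> keys v" by (auto simp: in_keys_iff)
  then show ?thesis
    by (simp add: lin_ext_superset[of "keys v"] scale_sum_right)
qed

sublocale lin_ext: additive "lin_ext f" for f :: "'l \<Rightarrow> 'b"
  by unfold_locales (rule lin_ext_add)

lemma lin_ext_single [simp]: "lin_ext f (single l a) = a *s f l"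
  by (cases "a = 0") (simp_all add: lin_ext_def)

lemma lin_ext_hom: "module_hom fscale scale (lin_ext f)"
  by unfold_locales (simp_all add: lin_ext_add lin_ext_fscale)

end

abbreviation slin where "slin \<equiv> free.lin_ext"

lemma slin_unit_vec: "slin unit_vec v = (v :: 'l \<Rightarrow>\<^sub>0 'a::comm_ring_1)"
  by (rule poly_mapping_eqI)
    (auto simp: free.lin_ext_def lookup_sum lookup_single when_def fscale_single in_keys_iff
      if_distrib[of "\<lambda>x. _ * x"] cong: if_cong)

text \<open>Over the coefficient field, \<open>'l \<Rightarrow>\<^sub>0 S\<close> has the basis of the cells \<open>x\<^sup>m l\<close>.
  \<open>supported Q\<close> is the span of those with \<open>Q m l\<close>.\<close>

definition supported ::
    "(('n \<Rightarrow>\<^sub>0 nat) \<Rightarrow> 'l \<Rightarrow> bool) \<Rightarrow> ('l \<Rightarrow>\<^sub>0 ('n, 'k::comm_ring_1) mpoly) set" where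
  "supported Q = {v. \<forall>l m. lookup (lookup v l) m \<noteq> 0 \<longrightarrow> Q m l}"

definition cell_ext ::
    "(('n \<Rightarrow>\<^sub>0 nat) \<Rightarrow> 'l \<Rightarrow> 'j \<Rightarrow>\<^sub>0 ('n, 'k::comm_ring_1) mpoly) \<Rightarrow>
     ('l \<Rightarrow>\<^sub>0 ('n, 'k) mpoly) \<Rightarrow> 'j \<Rightarrow>\<^sub>0 ('n, 'k) mpoly" where
  "cell_ext f v = (\<Sum>l\<in>keys v. \<Sum>m\<in>keys (lookup v l).
     fscale (single 0 (lookup (lookup v l) m)) (f m l))"

text \<open>Termination of \<open>hc\<close>, which recurses through \<open>cell_ext\<close>,
  depends on knowing that only cells in the support of the argument are visited.\<close>

lemma cell_ext_cong [fundef_cong]: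
  assumes "v = w"
    and "\<And>l m. l \<in> keys w \<Longrightarrow> m \<in> keys (lookup w l) \<Longrightarrow> f m l = g m l"
  shows "cell_ext f v = cell_ext g w"
  unfolding cell_ext_def using assms by (intro sum.cong) auto

section \<open>Calculus of supports and of \<open>k\<close>-linear extensions\<close>

lemma supportedI:
  "(\<And>l m. lookup (lookup v l) m \<noteq> 0 \<Longrightarrow> Q m l) \<Longrightarrow> v \<in> supported Q"
  by (simp add: supported_def)

lemma supportedD:
  "v \<in> supported Q \<Longrightarrow> lookup (lookup v l) m \<noteq> 0 \<Longrightarrow> Q m l"
  by (simp add: supported_def)

lemma supported_mono:
  "v \<in> supported Q \<Longrightarrow> (\<And>m l. Q m l \<Longrightarrow> Q' m l) \<Longrightarrow> v \<in> supported Q'"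
  by (auto simp: supported_def)

lemma supported_zero [simp]: "0 \<in> supported Q"
  by (simp add: supported_def)

lemma supported_add: "v \<in> supported Q \<Longrightarrow> w \<in> supported Q \<Longrightarrow> v + w \<in> supported Q"
  unfolding supported_def mem_Collect_eq lookup_add by (metis add.right_neutral)

lemma supported_uminus [simp]: "- v \<in> supported Q \<longleftrightarrow> v \<in> supported Q"
  by (simp add: supported_def)

lemma supported_diff: "v \<in> supported Q \<Longrightarrow> w \<in> supported Q \<Longrightarrow> v - w \<in> supported Q"
  using supported_add[of v Q "- w"] by simp

lemma supported_sum: "(\<And>x. x \<in> A \<Longrightarrow> f x \<in> supported Q) \<Longrightarrow> sum f A \<in> supported Q"
  by (induction A rule: infinite_finite_induct) (auto intro: supported_add)

lemma supported_single: "Q m l \<Longrightarrow> single l (single m a) \<in> supported Q"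
  by (auto simp: supported_def lookup_single when_def split: if_splits)

lemma supported_fscale:
  assumes v: "v \<in> supported Q"
    and Q: "\<And>t m l. t \<in> keys f \<Longrightarrow> Q m l \<Longrightarrow> Q' (t + m) l"
  shows "fscale f v \<in> supported Q'"
proof (rule supportedI)
  fix l s
  assume "lookup (lookup (fscale f v) l) s \<noteq> 0"
  then have "s \<in> keys (f * lookup v l)" by (simp add: in_keys_iff)
  then obtain t m where "s = t + m" "t \<in> keys f"
      "m \<in> keys (lookup v l)"
    using keys_mult by fastforce
  then show "Q' s l" using Q supportedD[OF v] by (auto simp: in_keys_iff)
qed

lemma supported_monom:
  assumes "v \<in> supported Q" and "\<And>m l. Q m l \<Longrightarrow> Q' (t + m) l"
  shows "fscale (monom t) v \<in> supported Q'"
  by (rule supported_fscale[OF assms(1)]) (auto intro: assms(2))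

lemma supported_unit_vec: "Q 0 l \<Longrightarrow> unit_vec l \<in> supported Q"
  using supported_single[of Q 0 l 1] by simp

lemma supported_monom_unit_vec: "Q t l \<Longrightarrow> fscale (monom t) (unit_vec l) \<in> supported Q"
  by (simp add: fscale_single monom_def supported_single)

lemma sum_singles: "(\<Sum>k\<in>keys p. single k (lookup p k)) = p"
  by (rule poly_mapping_eqI) (simp add: lookup_sum lookup_single when_def in_keys_iff)

lemma single_sum: "single l (sum f A) = (\<Sum>x\<in>A. single l (f x))"
  by (induction A rule: infinite_finite_induct) (simp_all add: single_add)

lemma sum_cells:
  "(\<Sum>l\<in>keys v. \<Sum>m\<in>keys (lookup v l).
     single l (single m (lookup (lookup v l) m))) = v"
  by (simp add: sum_singles flip: single_sum)

lemma supported_induct [consumes 1, case_names zero add cell]: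
  assumes v: "v \<in> supported Q"
    and zero: "P 0"
    and add: "\<And>x y. x \<in> supported Q \<Longrightarrow> y \<in> supported Q \<Longrightarrow> P x \<Longrightarrow> P y \<Longrightarrow> P (x + y)"
    and cell: "\<And>m l a. Q m l \<Longrightarrow> P (single l (single m a))"
  shows "P v"
proof -
  have inner: "P (sum f A) \<and> sum f A \<in> supported Q"
    if "\<And>x. x \<in> A \<Longrightarrow> P (f x) \<and> f x \<in> supported Q" for f and A :: "('b \<Rightarrow>\<^sub>0 nat) set"
    using that by (induction A rule: infinite_finite_induct) (auto intro: zero add supported_add)
  have outer: "P (sum f A) \<and> sum f A \<in> supported Q"
    if "\<And>x. x \<in> A \<Longrightarrow> P (f x) \<and> f x \<in> supported Q" for f and A :: "'a set"
    using that by (induction A rule: infinite_finite_induct) (auto intro: zero add supported_add)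
  show ?thesis
    by (subst sum_cells[symmetric], rule conjunct1, rule outer, rule inner)
      (auto intro!: cell supported_single supportedD[OF v] simp: in_keys_iff)
qed

lemma additive_supported:
  assumes "additive F" and "v \<in> supported Q"
    and "\<And>m l a. Q m l \<Longrightarrow> F (single l (single m a)) \<in> supported Q'"
  shows "F v \<in> supported Q'"
  using assms(2)
  by (induction rule: supported_induct)
    (auto simp: additive.zero[OF assms(1)] additive.add[OF assms(1)] intro: supported_add assms(3))

lemma single_eq_fscale:
  "single l (single m a) =
    fscale (single 0 a) (fscale (monom m) (unit_vec l))"
  by (simp add: fscale_single monom_def mult_single)

lemma supported_const:
  "v \<in> supported Q \<Longrightarrow> fscale (single 0 a) v \<in> supported Q"
  by (rule supported_fscale[where Q = Q]) (auto split: if_splits)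

lemma supported_sign:
  "v \<in> supported Q \<Longrightarrow> fscale ((-1) ^ n) v \<in> supported Q"
  by (cases "even n") simp_all

lemma slin_supported:
  assumes "v \<in> supported Q"
    and "\<And>m l. Q m l \<Longrightarrow> fscale (monom m) (f l) \<in> supported Q'"
  shows "slin f v \<in> supported Q'"
  by (rule additive_supported[OF _ assms(1)])
    (use assms(2) in \<open>simp_all add: additive_def free.lin_ext_add single_eq_fscale
      free.lin_ext_fscale supported_const del: free.scale_scale\<close>)

lemma cell_ext_superset:
  assumes "finite A" "finite M" "keys v \<subseteq> A"
    "\<And>l. keys (lookup v l) \<subseteq> M"
  shows "cell_ext f v = (\<Sum>l\<in>A. \<Sum>m\<in>M.
     fscale (single 0 (lookup (lookup v l) m)) (f m l))"
proof -
  have "cell_ext f v = (\<Sum>l\<in>keys v. \<Sum>m\<in>M.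
     fscale (single 0 (lookup (lookup v l) m)) (f m l))"
    unfolding cell_ext_def using assms
    by (intro sum.cong refl sum.mono_neutral_left) (auto simp: in_keys_iff)
  also have "\<dots> = (\<Sum>l\<in>A. \<Sum>m\<in>M.
     fscale (single 0 (lookup (lookup v l) m)) (f m l))"
    using assms by (intro sum.mono_neutral_left) (auto simp: in_keys_iff)
  finally show ?thesis .
qed

lemma cell_ext_add: "cell_ext f (v + w) = cell_ext f v + cell_ext f w"
proof -
  let ?A = "keys v \<union> keys w"
  let ?M = "\<Union>l\<in>?A. keys (lookup v l) \<union> keys (lookup w l)"
  have M: "keys (lookup v l) \<subseteq> ?M"
    "keys (lookup w l) \<subseteq> ?M" for l
    by (cases "l \<in> ?A"; auto simp: in_keys_iff)+
  have "keys (v + w) \<subseteq> ?A" by (rule keys_add)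
  moreover have "keys (lookup (v + w) l) \<subseteq> ?M" for l
    using M[of l] keys_add[of "lookup v l" "lookup w l"]
    by (simp add: lookup_add) blast
  ultimately show ?thesis
    using M by (simp add: cell_ext_superset[of ?A ?M] lookup_add single_add
      free.scale_left_distrib sum.distrib)
qed

lemma additive_cell_ext: "additive (cell_ext f)"
  by unfold_locales (rule cell_ext_add)

lemma cell_ext_single:
  "cell_ext f (single l (single m a)) =
    fscale (single 0 a) (f m l)"
proof (cases "a = 0")
  case False
  then have "single m a \<noteq> 0" by (metis lookup_single_eq lookup_zero)
  with False show ?thesis by (simp add: cell_ext_def)
qed (simp add: cell_ext_def)

lemma cell_ext_monom: "cell_ext f (fscale (monom m) (unit_vec l)) = f m l"
  using cell_ext_single[of f l m 1] by (simp add: fscale_single monom_def)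

lemma cell_ext_const:
  "cell_ext f (fscale (single 0 a) v) = fscale (single 0 a) (cell_ext f v)"
proof -
  have "v \<in> supported (\<lambda>_ _. True)" by (rule supportedI) simp
  then show ?thesis
    by (induction rule: supported_induct)
      (simp_all add: additive.zero[OF additive_cell_ext] cell_ext_add free.scale_right_distrib
        fscale_single mult_single cell_ext_single)
qed

lemma additive_sign:
  assumes "additive F"
  shows "F (fscale ((-1) ^ n) v) = fscale ((-1) ^ n) (F v)"
  by (cases "even n") (simp_all add: additive.minus[OF assms])

section \<open>A model resolution\<close>

text \<open>\<open>Bot\<close> spans the module in degree 0, and \<open>Lab p u\<close> is the symbol \<open>(set p; u)\<close>, where \<open>p\<close> is
  strictly increasing.\<close>

datatype 'n label = Bot | Lab "'n list" "'n \<Rightarrow>\<^sub>0 nat"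

abbreviation xp :: "'n \<Rightarrow> 'n \<Rightarrow>\<^sub>0 nat" where
  "xp i \<equiv> single i 1"

definition mdeg :: "('n::finite \<Rightarrow>\<^sub>0 nat) \<Rightarrow> nat" where
  "mdeg m = (\<Sum>i\<in>UNIV. lookup m i)"

lemma mdeg_add [simp]: "mdeg (a + b) = mdeg a + mdeg b"
  by (simp add: mdeg_def lookup_add sum.distrib)

lemma mdeg_zero [simp]: "mdeg 0 = 0"
  by (simp add: mdeg_def)

lemma mdeg_single [simp]: "mdeg (single i k) = k"
  by (simp add: mdeg_def lookup_single when_def)

lemma mdeg_eq_0 [simp]: "mdeg m = 0 \<longleftrightarrow> m = 0"
  by (auto simp: mdeg_def intro: poly_mapping_eqI)

lemma mdeg_pos: "m \<noteq> 0 \<Longrightarrow> mdeg m > 0"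
  by (metis mdeg_eq_0 gr0I)

lemma keys_add_nat [simp]:
  "keys (a + b) = keys a \<union> keys (b :: 'n \<Rightarrow>\<^sub>0 nat)"
  by (auto simp: in_keys_iff lookup_add)

lemma xp_neq_0 [simp]: "xp i \<noteq> 0"
  by (metis lookup_single_eq lookup_zero one_neq_zero)

lemma diff_xp_add: "i \<in> keys m \<Longrightarrow> m - xp i + xp i = m"
  by (rule poly_mapping_eqI) (auto simp: lookup_add lookup_minus lookup_single when_def in_keys_iff)

lemma add_xp_diff [simp]: "xp i + m - xp i = m"
  by (rule poly_mapping_eqI) (auto simp: lookup_add lookup_minus)

abbreviation cell :: "('n \<Rightarrow>\<^sub>0 nat) \<Rightarrow> 'l \<Rightarrow> 'l \<Rightarrow>\<^sub>0 ('n, 'k::comm_ring_1) mpoly" where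
  "cell m l \<equiv> fscale (monom m) (unit_vec l)"

text \<open>
  The exponent \<open>g m\<close> is the generator part of \<open>m\<close>. The flag \<open>sep\<close> is the matroidal case and
  \<open>\<not> sep\<close> the stable one; its assumptions control the product with a generator (\<open>hc_generator\<close>).
\<close>

locale regular_decomposition =
  fixes I :: "('n::{finite,linorder}, 'k::field) mpoly set"
    and st :: "('n \<Rightarrow>\<^sub>0 nat) \<Rightarrow> 'n set"
    and g :: "('n \<Rightarrow>\<^sub>0 nat) \<Rightarrow> 'n \<Rightarrow>\<^sub>0 nat"
    and sep :: bool
  assumes ideal_eq: "f \<in> I \<longleftrightarrow> (\<forall>m\<in>keys f. \<exists>u\<in>min_gens I. \<exists>y. m = u + y)"
    and zero_notin: "0 \<notin> min_gens I"
    and antichain: "u \<in> min_gens I \<Longrightarrow> u + y \<in> min_gens I \<Longrightarrow> y = 0"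
    and g_in: "u \<in> min_gens I \<Longrightarrow> g (u + y) \<in> min_gens I"
    and g_split: "u \<in> min_gens I \<Longrightarrow> \<exists>z. u + y = g (u + y) + z \<and> keys z \<inter> st (g (u + y)) = {}"
    and g_unique: "u \<in> min_gens I \<Longrightarrow> keys y \<inter> st u = {} \<Longrightarrow> g (u + y) = u"
    and st_mono: "u \<in> min_gens I \<Longrightarrow> i \<in> st u \<Longrightarrow> st (g (u + xp i)) \<subseteq> st u"
    and st_sep: "sep \<Longrightarrow> u \<in> min_gens I \<Longrightarrow> i \<in> st u \<Longrightarrow> i \<notin> st (g (u + xp i))"
    and st_exchange: "sep \<Longrightarrow> u \<in> min_gens I \<Longrightarrow> v \<in> min_gens I \<Longrightarrow> j \<in> st v \<Longrightarrow> j \<notin> st u \<Longrightarrow>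
      \<exists>i\<in>keys u \<inter> st v. i \<le> j"
    and st_initial: "\<not> sep \<Longrightarrow> u \<in> min_gens I \<Longrightarrow> j \<notin> st u \<Longrightarrow> i \<in> keys u \<Longrightarrow> i \<le> j"
begin

abbreviation G where "G \<equiv> min_gens I"

definition M :: "('n \<Rightarrow>\<^sub>0 nat) set" where
  "M = {u + y |u y. u \<in> G}"

text \<open>The homotopy acts on \<open>x\<^sup>m (Lab p u)\<close> through the variables of \<open>m\<close> in \<open>N p u\<close>, which can be
  prepended to \<open>p\<close>.\<close>

definition N :: "'n list \<Rightarrow> ('n \<Rightarrow>\<^sub>0 nat) \<Rightarrow> 'n set" where
  "N p u = {j \<in> st u. \<forall>l\<in>set p. j < l}"

primrec valid :: "'n label \<Rightarrow> bool" where
  "valid Bot = True"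
| "valid (Lab p u) = (u \<in> G \<and> sorted_wrt (<) p \<and> set p \<subseteq> st u)"

primrec level :: "'n label \<Rightarrow> nat" where
  "level Bot = 0"
| "level (Lab p u) = Suc (length p)"

primrec ldeg :: "'n label \<Rightarrow> nat" where
  "ldeg Bot = 0"
| "ldeg (Lab p u) = length p + mdeg u"

lemma N_Nil [simp]: "N [] u = st u" by (simp add: N_def)
lemma N_Cons: "N (i # p) u = {j \<in> N p u. j < i}" by (auto simp: N_def)
lemma N_subset: "N p u \<subseteq> st u" by (auto simp: N_def)
lemma valid_Cons: "valid (Lab (i # p) u) \<longleftrightarrow> valid (Lab p u) \<and> i \<in> N p u"
  by (auto simp: N_def)

definition Aop :: "'n \<Rightarrow> ('n label \<Rightarrow>\<^sub>0 ('n, 'k) mpoly) \<Rightarrow> 'n label \<Rightarrow>\<^sub>0 ('n, 'k) mpoly" where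
  "Aop i = slin (\<lambda>l. case l of Bot \<Rightarrow> 0 | Lab p u \<Rightarrow> if i \<in> N p u then unit_vec (Lab (i # p) u) else 0)"

text \<open>
  \<open>R (i # p) u\<close> is the part of the differential of \<open>Lab (i # p) u\<close> other than \<open>x\<^sub>i (Lab p u)\<close>. The
  recursion solves \<open>R (i # p) u = - h (x\<^sub>i d (Lab p u))\<close>, see \<open>D_eq_h\<close>: on the cells that occur,
  \<open>h\<close> after multiplication by \<open>x\<^sub>i\<close> is the \<open>S\<close>-linear map \<open>Aop i\<close>.
\<close>

fun R :: "'n list \<Rightarrow> ('n \<Rightarrow>\<^sub>0 nat) \<Rightarrow> 'n label \<Rightarrow>\<^sub>0 ('n, 'k) mpoly" where
  "R [] u = 0"
| "R [i] u = - cell (u + xp i - g (u + xp i)) (Lab [] (g (u + xp i)))"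
| "R (i # j # p) u = - cell (xp j) (Lab (i # p) u) + Aop j (R (i # p) u) - Aop i (R (j # p) u)"

fun D :: "'n label \<Rightarrow> 'n label \<Rightarrow>\<^sub>0 ('n, 'k) mpoly" where
  "D Bot = 0"
| "D (Lab [] u) = cell u Bot"
| "D (Lab (i # p) u) = cell (xp i) (Lab p u) + R (i # p) u"

definition bdry where "bdry = slin D"

text \<open>The cells \<open>x\<^sup>m l\<close> that the contracting homotopy kills.\<close>

definition Bcell :: "('n \<Rightarrow>\<^sub>0 nat) \<Rightarrow> 'n label \<Rightarrow> bool" where
  "Bcell m l \<longleftrightarrow> (\<exists>p u. l = Lab p u \<and> valid l \<and> keys m \<inter> N p u = {})"

text \<open>What is needed of a term of \<open>R (i # p) u\<close>: inactivity makes
  \<open>h\<close> kill it, the inclusion of active sets makes the recursion of \<open>hc\<close>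
  terminate, \<open>m \<noteq> 0\<close> yields a minimal differential, and the last two equations
  give the level and the internal degree. The clause for \<open>sep\<close> says that
  \<open>x_i\<close> cannot be used a second time.\<close>

definition Rcell :: "'n \<Rightarrow> 'n list \<Rightarrow> ('n \<Rightarrow>\<^sub>0 nat) \<Rightarrow> ('n \<Rightarrow>\<^sub>0 nat) \<Rightarrow> 'n label \<Rightarrow> bool" where
  "Rcell i p u m l \<longleftrightarrow> (\<exists>q v. l = Lab q v \<and> valid l \<and> m \<noteq> 0 \<and>
     keys m \<inter> N q v = {} \<and> N q v \<subseteq> N p u \<and> (sep \<longrightarrow> i \<notin> N q v) \<and>
     length q = length p \<and> mdeg m + mdeg v = Suc (mdeg u))"

section \<open>The terms of the differential\<close>

lemma Aop_add: "Aop i (v + w) = Aop i v + Aop i w"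
  by (simp add: Aop_def free.lin_ext_add)

lemma additive_Aop: "additive (Aop i)"
  by unfold_locales (rule Aop_add)

lemma Aop_supported:
  assumes "v \<in> supported Q" and "\<And>m p u. Q m (Lab p u) \<Longrightarrow> i \<in> N p u \<Longrightarrow> Q' m (Lab (i # p) u)"
  shows "Aop i v \<in> supported Q'"
  unfolding Aop_def
  by (rule slin_supported[OF assms(1)])
    (auto split: label.splits simp: assms(2) intro: supported_monom_unit_vec)

lemma g_props:
  assumes "m \<in> M"
  shows "g m \<in> G" "g m + (m - g m) = m" "m - g m + g m = m"
    "keys (m - g m) \<inter> st (g m) = {}"
proof -
  obtain u y where u: "u \<in> G" "m = u + y" using assms by (auto simp: M_def)
  obtain z where z: "m = g m + z" "keys z \<inter> st (g m) = {}"
    using g_split[OF u(1), of y] u by auto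
  have "m - g m = z" by (subst z(1)) simp
  with z show "g m + (m - g m) = m" "m - g m + g m = m"
    "keys (m - g m) \<inter> st (g m) = {}" by (simp_all add: add.commute)
  show "g m \<in> G" using g_in[OF u(1)] u by simp
qed

lemma in_M: "u \<in> G \<Longrightarrow> u + y \<in> M" "u \<in> G \<Longrightarrow> y + u \<in> M"
  by (auto simp: M_def) (metis add.commute)

lemma R_supported:
  "valid (Lab (i # p) u) \<Longrightarrow> R (i # p) u \<in> supported (Rcell i p u)"
proof (induction p arbitrary: i)
  case Nil
  then have u: "u \<in> G" "i \<in> st u" by auto
  let ?w = "g (u + xp i)" and ?y = "u + xp i - g (u + xp i)"
  note w = g_props[OF in_M(1)[OF u(1), of "xp i"]]
  have "?y \<noteq> 0"
  proof
    assume "?y = 0"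
    then have "u + xp i \<in> G" using w(1,2) by (metis add.right_neutral)
    from antichain[OF u(1) this] show False using xp_neq_0 by metis
  qed
  moreover have "mdeg ?y + mdeg ?w = Suc (mdeg u)"
    using arg_cong[OF w(3), of mdeg] by simp
  ultimately have "Rcell i [] u ?y (Lab [] ?w)"
    using w st_mono[OF u] st_sep[OF _ u] by (auto simp: Rcell_def)
  then show ?case by (simp add: supported_monom_unit_vec del: One_nat_def)
next
  case (Cons j p)
  then have v: "valid (Lab (j # p) u)" "i \<in> N (j # p) u" "valid (Lab p u)" "j \<in> N p u"
    by (simp_all only: valid_Cons)
  then have ij: "i < j" "i \<in> N p u" by (auto simp: N_Cons)
  have v': "valid (Lab (i # p) u)" using v ij by (simp only: valid_Cons)
  have 1: "cell (xp j) (Lab (i # p) u) \<in> supported (Rcell i (j # p) u)"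
    using v' ij v(4) by (intro supported_monom_unit_vec)
      (auto simp: Rcell_def N_Cons simp del: valid.simps One_nat_def)
  have 2: "Aop j (R (i # p) u) \<in> supported (Rcell i (j # p) u)"
    by (rule Aop_supported[OF Cons.IH[OF v']])
      (auto simp: Rcell_def N_Cons valid_Cons simp del: valid.simps)
  have 3: "Aop i (R (j # p) u) \<in> supported (Rcell i (j # p) u)"
    using ij by (intro Aop_supported[OF Cons.IH[OF v(1)]])
      (auto simp: Rcell_def N_Cons valid_Cons simp del: valid.simps)
  have "- cell (xp j) (Lab (i # p) u) \<in> supported (Rcell i (j # p) u)" using 1 by simp
  then show ?case unfolding R.simps by (intro supported_diff supported_add 2 3)
qed

text \<open>Decreases along the recursion of the contraction, since the variables of a cell of \<open>R (i # p) u\<close>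
  are inactive there and its active variables are active for \<open>Lab p u\<close>.\<close>

definition active_degree :: "('n \<Rightarrow>\<^sub>0 nat) \<Rightarrow> 'n label \<Rightarrow> nat" where
  "active_degree m l = (case l of Bot \<Rightarrow> 0 | Lab p u \<Rightarrow> (\<Sum>i\<in>N p u. lookup m i))"

lemma active_degree_less:
  assumes "Rcell i p u s l" and "j \<in> N p u"
  shows "active_degree (t + s) l < active_degree (t + xp j) (Lab p u)"
proof -
  obtain q v where l: "l = Lab q v" "keys s \<inter> N q v = {}" "N q v \<subseteq> N p u"
    using assms(1) by (auto simp: Rcell_def)
  have "(\<Sum>i\<in>N q v. lookup (t + s) i) = (\<Sum>i\<in>N q v. lookup t i)"
    using l by (intro sum.cong) (auto simp: lookup_add in_keys_iff)
  also have "\<dots> \<le> (\<Sum>i\<in>N p u. lookup t i)"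
    using l by (intro sum_mono2) auto
  also have "\<dots> < (\<Sum>i\<in>N p u. lookup (t + xp j) i)"
    using assms(2) by (intro sum_strict_mono_ex1) (auto simp: lookup_add lookup_single when_def)
  finally show ?thesis by (simp add: active_degree_def l)
qed

section \<open>The contraction \<open>h\<close>\<close>

definition lead :: "('n \<Rightarrow>\<^sub>0 nat) \<Rightarrow> 'n list \<Rightarrow> ('n \<Rightarrow>\<^sub>0 nat) \<Rightarrow> 'n" where
  "lead m p u = Min (keys m \<inter> N p u)"

lemma lead_in:
  assumes "keys m \<inter> N p u \<noteq> {}"
  shows "lead m p u \<in> keys m" "lead m p u \<in> N p u"
  using Min_in[of "keys m \<inter> N p u"] assms by (auto simp: lead_def)

lemma lead_le: "j \<in> keys m \<Longrightarrow> j \<in> N p u \<Longrightarrow> lead m p u \<le> j"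
  by (simp add: lead_def)

text \<open>If \<open>i\<close> is the least active variable and \<open>m = x\<^sub>i t\<close>, then \<open>x\<^sup>m (Lab p u)\<close> is the leading cell of
  the boundary of \<open>x\<^sup>t (Lab (i # p) u)\<close>.\<close>

function hc :: "('n \<Rightarrow>\<^sub>0 nat) \<Rightarrow> 'n label \<Rightarrow> 'n label \<Rightarrow>\<^sub>0 ('n, 'k) mpoly" where
  "hc m Bot = (if m \<in> M then cell (m - g m) (Lab [] (g m)) else 0)"
| "hc m (Lab p u) = (if valid (Lab p u) \<and> keys m \<inter> N p u \<noteq> {} then
     cell (m - xp (lead m p u)) (Lab (lead m p u # p) u) -
     cell_ext hc (fscale (monom (m - xp (lead m p u))) (R (lead m p u # p) u)) else 0)"
  by pat_completeness auto
termination
proof (relation "measure (\<lambda>(m, l). active_degree m l)")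
  fix m p u and l :: "'n label" and s
  let ?i = "lead m p u"
  let ?v = "fscale (monom (m - xp ?i)) (R (?i # p) u) :: 'n label \<Rightarrow>\<^sub>0 ('n, 'k) mpoly"
  assume a: "valid (Lab p u) \<and> keys m \<inter> N p u \<noteq> {}"
    and s: "s \<in> keys (lookup ?v l)"
  then have i: "?i \<in> N p u" "?i \<in> keys m" "valid (Lab (?i # p) u)"
    using lead_in[of m p u] by (simp_all only: valid_Cons) auto
  have "?v \<in> supported (\<lambda>m' l. \<exists>t. m' = m - xp ?i + t \<and> Rcell ?i p u t l)"
    by (rule supported_monom[OF R_supported[OF i(3)]]) auto
  with s obtain t where "s = m - xp ?i + t" "Rcell ?i p u t l"
    by (auto simp: in_keys_iff dest: supportedD)
  with active_degree_less[OF this(2) i(1), of "m - xp ?i"]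
  show "((s, l), m, Lab p u) \<in> measure (\<lambda>(m, l). active_degree m l)"
    by (simp add: diff_xp_add i)
qed simp

declare hc.simps [simp del]

definition h where "h = cell_ext hc"

lemma additive_h: "additive h"
  unfolding h_def by (rule additive_cell_ext)

lemma h_const: "h (fscale (single 0 a) v) = fscale (single 0 a) (h v)"
  by (simp add: h_def cell_ext_const)

lemma h_cell: "h (cell m l) = hc m l"
  by (simp add: h_def cell_ext_monom)

lemma h_single: "h (single l (single m a)) = fscale (single 0 a) (hc m l)"
  by (simp add: h_def cell_ext_single)

lemma hc_Bcell: "Bcell m l \<Longrightarrow> hc m l = 0"
  by (auto simp: Bcell_def hc.simps)

lemma h_Bcell: "v \<in> supported Bcell \<Longrightarrow> h v = 0"
  by (induction rule: supported_induct)
    (simp_all add: additive.zero[OF additive_h] additive.add[OF additive_h] h_single hc_Bcell)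

lemma Bcell_Rcell:
  assumes "Rcell i p u s l" "keys t \<inter> N p u = {}"
  shows "Bcell (t + s) l"
  using assms unfolding Rcell_def Bcell_def keys_add_nat by blast

lemma monom_R_Bcell:
  assumes "valid (Lab (i # p) u)" "keys t \<inter> N p u = {}"
  shows "fscale (monom t) (R (i # p) u) \<in> supported Bcell"
  by (rule supported_monom[OF R_supported[OF assms(1)]]) (rule Bcell_Rcell[OF _ assms(2)])

text \<open>One step of the recursion with \<open>lead\<close> eliminated: the condition on
  \<open>t\<close>, which may itself contain \<open>x_i\<close>, makes \<open>i\<close> the least
  active variable.\<close>

lemma hc_lead:
  assumes v: "valid (Lab p u)" and i: "i \<in> N p u" and t: "keys t \<inter> {j \<in> N p u. j < i} = {}"
  shows "hc (xp i + t) (Lab p u) = cell t (Lab (i # p) u) - h (fscale (monom t) (R (i # p) u))"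
proof -
  have "lead (xp i + t) p u = i"
    unfolding lead_def using i t by (intro Min_eqI) (auto simp: not_less[symmetric])
  then show ?thesis using v i
    by (subst hc.simps) (auto simp: h_def simp del: valid.simps)
qed

text \<open>In \<open>x_i\<close> times an inactive cell at most \<open>i\<close> is active, so the
  recursion stops after one step: the correction coming from \<open>R\<close> is again inactive and
  is killed.\<close>

lemma h_xp_Bcell:
  assumes "v \<in> supported Bcell"
  shows "h (fscale (monom (xp i)) v) = Aop i v"
  using assms
proof (induction rule: supported_induct)
  case zero
  then show ?case by (simp add: additive.zero[OF additive_h] additive.zero[OF additive_Aop])
next
  case (add x y)
  then show ?case
    by (simp add: additive.add[OF additive_h] additive.add[OF additive_Aop] free.scale_right_distrib)
next
  case (cell m l a)
  then obtain p u where l: "l = Lab p u" "valid l" "keys m \<inter> N p u = {}"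
    by (auto simp: Bcell_def)
  have "h (fscale (monom (xp i)) (single l (single m a))) =
    fscale (single 0 a) (hc (xp i + m) l)"
    by (simp add: fscale_single monom_def mult_single h_single)
  also have "hc (xp i + m) l = (if i \<in> N p u then cell m (Lab (i # p) u) else 0)"
  proof (cases "i \<in> N p u")
    case True
    have "h (fscale (monom m) (R (i # p) u)) = 0"
      by (rule h_Bcell, rule monom_R_Bcell) (use l True in \<open>simp_all only: valid_Cons\<close>)
    then show ?thesis
      using True l by (subst l(1), subst hc_lead) auto
  next
    case False
    then show ?thesis using l by (auto simp: hc.simps)
  qed
  also have "fscale (single 0 a) \<dots> = Aop i (single l (single m a))"
    by (simp add: Aop_def l fscale_single monom_def mult_single)
  finally show ?case .
qed

lemma bdry_add: "bdry (v + w) = bdry v + bdry w"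
  by (simp add: bdry_def free.lin_ext_add)

lemma additive_bdry: "additive bdry"
  by unfold_locales (rule bdry_add)

lemma bdry_fscale: "bdry (fscale f v) = fscale f (bdry v)"
  by (simp add: bdry_def free.lin_ext_fscale)

lemma bdry_unit_vec [simp]: "bdry (unit_vec l) = D l"
  by (simp add: bdry_def)

lemma bdry_single: "bdry (single l a) = fscale a (D l)"
  by (simp add: bdry_def)

text \<open>The boundary of an inactive cell is its leading cell plus a multiple of
  \<open>R\<close>, and \<open>hc_lead\<close> returns the original cell minus exactly
  \<open>h\<close> of that multiple. For an empty list this is the uniqueness of the decomposition
  of a monomial of the ideal.\<close>

lemma h_bdry_Bcell:
  assumes "v \<in> supported Bcell"
  shows "h (bdry v) = v"
  using assms
proof (induction rule: supported_induct)
  case zero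
  then show ?case by (simp add: additive.zero[OF additive_h] additive.zero[OF additive_bdry])
next
  case (add x y)
  then show ?case by (simp add: additive.add[OF additive_h] bdry_add)
next
  case (cell m l a)
  then obtain p u where l: "l = Lab p u" "valid l" "keys m \<inter> N p u = {}"
    by (auto simp: Bcell_def)
  have "h (bdry (cell m l)) = cell m l"
  proof (cases p)
    case Nil
    have "h (bdry (cell m l)) = hc (m + u) Bot"
      by (simp add: bdry_fscale l Nil monom_mult h_cell[symmetric])
    also have "\<dots> = cell m l"
    proof -
      have "u \<in> G" "g (u + m) = u" using l Nil g_unique by auto
      then show ?thesis using in_M[of u m] by (simp add: hc.simps l Nil add.commute)
    qed
    finally show ?thesis .
  next
    case (Cons i q)
    then have v: "valid (Lab q u)" "i \<in> N q u" using l by (simp_all only: valid_Cons)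
    have "bdry (cell m l) = cell (xp i + m) (Lab q u) + fscale (monom m) (R p u)"
      by (simp add: bdry_fscale l Cons free.scale_right_distrib monom_mult add.commute)
    then have "h (bdry (cell m l)) = hc (xp i + m) (Lab q u) + h (fscale (monom m) (R p u))"
      by (simp add: additive.add[OF additive_h] h_cell)
    also have "\<dots> = cell m l"
      by (subst hc_lead) (use v l Cons in \<open>auto simp: N_Cons\<close>)
    finally show ?thesis .
  qed
  then show ?case
    by (simp only: single_eq_fscale bdry_fscale h_const)
qed


lemma R_Bcell: "valid (Lab (i # p) u) \<Longrightarrow> R (i # p) u \<in> supported Bcell"
  using monom_R_Bcell[of i p u 0] by simp

text \<open>This is the homotopy identity at \<open>x_i (Lab p u)\<close>, an element that
  \<open>h\<close> sends to \<open>Lab (i # p) u\<close>. It reduces \<open>d d = 0\<close> to the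
  homotopy identity at lower levels.\<close>

lemma D_eq_h:
  assumes v: "valid (Lab (i # p) u)"
  shows "D (Lab (i # p) u) = cell (xp i) (Lab p u) - h (fscale (monom (xp i)) (D (Lab p u)))"
proof (cases p)
  case Nil
  have "u + xp i \<in> M" using v in_M by simp
  then show ?thesis
    by (simp add: Nil monom_mult h_cell hc.simps add.commute del: free.scale_scale)
      (simp add: monom_mult h_cell hc.simps add.commute)
next
  case (Cons j q)
  have v': "valid (Lab (j # q) u)" "i \<in> N (j # q) u" "valid (Lab q u)" "j \<in> N q u"
    using v unfolding Cons by (simp_all only: valid_Cons)
  then have ij: "i < j" "i \<in> N q u" by (auto simp: N_Cons)
  have "h (fscale (monom (xp i)) (D (Lab p u))) =
      h (cell (xp i + xp j) (Lab q u)) + h (fscale (monom (xp i)) (R (j # q) u))"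
    by (simp add: Cons free.scale_right_distrib additive.add[OF additive_h] monom_mult)
  also have "h (fscale (monom (xp i)) (R (j # q) u)) = Aop i (R (j # q) u)"
    by (rule h_xp_Bcell[OF R_Bcell[OF v'(1)]])
  also have "h (cell (xp i + xp j) (Lab q u)) = cell (xp j) (Lab (i # q) u) - h (fscale (monom (xp j)) (R (i # q) u))"
    unfolding h_cell by (rule hc_lead) (use ij v' in auto)
  also have "h (fscale (monom (xp j)) (R (i # q) u)) = Aop j (R (i # q) u)"
    by (rule h_xp_Bcell, rule R_Bcell) (use v' ij in \<open>simp only: valid_Cons\<close>)
  finally show ?thesis by (simp add: Cons)
qed

section \<open>The homotopy identity and \<open>d d = 0\<close>\<close>

definition homotopic :: "('n label \<Rightarrow>\<^sub>0 ('n, 'k) mpoly) \<Rightarrow> bool" where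
  "homotopic v \<longleftrightarrow> bdry (h v) + h (bdry v) = v"

lemma homotopic_supported:
  assumes "v \<in> supported Q" and "\<And>m l. Q m l \<Longrightarrow> homotopic (cell m l)"
  shows "homotopic v"
  using assms(1)
proof (induction rule: supported_induct)
  case zero
  then show ?case by (simp add: homotopic_def additive.zero[OF additive_h] additive.zero[OF additive_bdry])
next
  case (add x y)
  then show ?case
    by (simp add: homotopic_def additive.add[OF additive_h] additive.add[OF additive_bdry] algebra_simps)
next
  case (cell m l a)
  from assms(2)[OF this] show ?case
    unfolding homotopic_def single_eq_fscale bdry_fscale h_const
    by (simp flip: free.scale_right_distrib del: free.scale_scale)
qed

lemma homotopic_Bcell: "v \<in> supported Bcell \<Longrightarrow> homotopic v"
  by (simp add: homotopic_def h_Bcell h_bdry_Bcell additive.zero[OF additive_bdry])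

lemma homotopic_Bot: "m \<in> M \<Longrightarrow> homotopic (cell m Bot)"
  using g_props(3)[of m]
  by (simp add: homotopic_def h_cell hc.simps bdry_fscale additive.zero[OF additive_h] monom_mult)

text \<open>Stated relative to \<open>d d = 0\<close> up to the next level, because
  \<open>bdry_D\<close> in turn uses this identity at lower levels. An active cell equals
  \<open>bdry ?b - ?R\<close>, where \<open>bdry (bdry ?b) = 0\<close>,
  \<open>h (bdry ?b) = ?b\<close>, and the cells of \<open>?R\<close> have smaller active
  degree.\<close>

lemma homotopic_Lab:
  assumes "\<And>l. valid l \<Longrightarrow> level l \<le> Suc n \<Longrightarrow> bdry (D l) = 0"
    and "valid (Lab p u)" "level (Lab p u) = n"
  shows "homotopic (cell m (Lab p u))"
  using assms(2,3)
proof (induction "active_degree m (Lab p u)" arbitrary: m p u rule: less_induct)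
  case less
  show ?case
  proof (cases "keys m \<inter> N p u = {}")
    case True
    then have "Bcell m (Lab p u)" using less.prems by (auto simp: Bcell_def)
    then show ?thesis by (intro homotopic_Bcell supported_monom_unit_vec)
  next
    case False
    define i where "i = lead m p u"
    define t where "t = m - xp i"
    have i: "i \<in> N p u" "m = xp i + t" "keys t \<inter> {j \<in> N p u. j < i} = {}"
    proof -
      show "i \<in> N p u" and m: "m = xp i + t"
        using lead_in[OF False] diff_xp_add[of i m] by (simp_all add: i_def t_def add.commute)
      show "keys t \<inter> {j \<in> N p u. j < i} = {}"
        using lead_le[of _ m p u] unfolding i_def[symmetric] by (auto simp: m not_less[symmetric])
    qed
    have v: "valid (Lab (i # p) u)" using less.prems i(1) by (simp only: valid_Cons)
    let ?R = "fscale (monom t) (R (i # p) u)" and ?b = "cell t (Lab (i # p) u)"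
    have "homotopic ?R"
    proof (rule homotopic_supported)
      show "?R \<in> supported (\<lambda>m' l. \<exists>s. m' = t + s \<and> Rcell i p u s l)"
        by (rule supported_monom[OF R_supported[OF v]]) auto
      fix m' l assume "\<exists>s. m' = t + s \<and> Rcell i p u s l"
      then obtain s where s: "m' = t + s" "Rcell i p u s l" by auto
      then obtain q w where l: "l = Lab q w" "valid (Lab q w)" "length q = length p"
        by (auto simp: Rcell_def)
      have "active_degree m' l < active_degree m (Lab p u)"
        using active_degree_less[OF s(2) i(1), of t] by (simp add: s i(2) add.commute)
      with less l show "homotopic (cell m' l)" by auto
    qed
    then have R: "bdry (h ?R) + h (bdry ?R) = ?R" by (simp add: homotopic_def)
    have d0: "bdry (bdry ?b) = 0"
      using assms(1)[OF v] less.prems by (simp add: bdry_fscale)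
    have b: "bdry ?b = cell m (Lab p u) + ?R"
      by (simp add: bdry_fscale i(2) monom_mult free.scale_right_distrib add.commute)
    have "Bcell t (Lab (i # p) u)" using v i by (auto simp: Bcell_def N_Cons)
    then have hd: "h (bdry ?b) = ?b" by (intro h_bdry_Bcell supported_monom_unit_vec)
    have hm: "h (cell m (Lab p u)) = ?b - h ?R"
      using hd unfolding b by (simp add: additive.add[OF additive_h] algebra_simps)
    have dm: "bdry (cell m (Lab p u)) = - bdry ?R"
      using d0 unfolding b by (simp add: bdry_add eq_neg_iff_add_eq_0)
    show ?thesis
      unfolding homotopic_def hm dm additive.diff[OF additive_bdry] additive.minus[OF additive_h] b
      using R by (simp add: algebra_simps)
  qed
qed

definition Dcell :: "nat \<Rightarrow> nat \<Rightarrow> ('n \<Rightarrow>\<^sub>0 nat) \<Rightarrow> 'n label \<Rightarrow> bool" where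
  "Dcell n j m l \<longleftrightarrow> valid l \<and> level l = n \<and> mdeg m + ldeg l = j"

lemma D_supported:
  assumes "valid (Lab p u)"
  shows "D (Lab p u) \<in> supported (\<lambda>m l. m \<noteq> 0 \<and> Dcell (length p) (length p + mdeg u) m l)"
proof (cases p)
  case Nil
  have "u \<noteq> 0" using assms zero_notin by auto
  then show ?thesis by (auto simp: Nil Dcell_def intro: supported_monom_unit_vec)
next
  case (Cons i q)
  have v: "valid (Lab (i # q) u)" "valid (Lab q u)" using assms unfolding Cons valid_Cons by auto
  show ?thesis
    unfolding Cons D.simps
  proof (intro supported_add supported_monom_unit_vec supported_mono[OF R_supported[OF v(1)]])
    show "xp i \<noteq> 0 \<and> Dcell (length (i # q)) (length (i # q) + mdeg u) (xp i) (Lab q u)"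
      using v by (simp add: Dcell_def del: valid.simps)
  qed (auto simp: Rcell_def Dcell_def simp del: valid.simps)
qed

lemma bdry_D: "valid l \<Longrightarrow> bdry (D l) = 0"
proof (induction "level l" arbitrary: l rule: less_induct)
  case less
  consider "l = Bot" | u where "l = Lab [] u" | i p u where "l = Lab (i # p) u"
    by (cases rule: D.cases[of l]) auto
  then show ?case
  proof cases
    case 1
    then show ?thesis by (simp add: additive.zero[OF additive_bdry])
  next
    case 2
    then show ?thesis by (simp add: bdry_fscale)
  next
    case 3
    then have v: "valid (Lab (i # p) u)" "valid (Lab p u)"
      using less.prems unfolding 3 valid_Cons by auto
    let ?x = "fscale (monom (xp i)) (D (Lab p u))"
    have "bdry ?x = 0" using less.hyps[OF _ v(2)] by (simp add: bdry_fscale 3)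
    moreover have "homotopic ?x"
    proof (cases p)
      case Nil
      have "xp i + u \<in> M" using v in_M by simp
      then show ?thesis using homotopic_Bot by (simp add: Nil monom_mult)
    next
      case (Cons j q)
      show ?thesis
      proof (rule homotopic_supported)
        show "?x \<in> supported (\<lambda>m l. valid l \<and> level l = length p)"
          by (rule supported_monom[OF D_supported[OF v(2)]]) (simp add: Dcell_def)
        fix m l' assume l': "valid l' \<and> level l' = length p"
        then obtain q' w where "l' = Lab q' w" using Cons by (cases l') auto
        \<comment> \<open>Level \<open>length p\<close> needs \<open>d d = 0\<close> up to level
          \<open>length p + 1\<close>, just below the level \<open>length p + 2\<close> of
          \<open>Lab (i # p) u\<close>.\<close>
        then show "homotopic (cell m l')"
          using l' less.hyps by (auto simp: 3 less_Suc_eq_le intro!: homotopic_Lab[of "length p"])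
      qed
    qed
    ultimately show ?thesis
      by (simp add: 3 D_eq_h[OF v(1)] additive.diff[OF additive_bdry] bdry_fscale homotopic_def
          additive.zero[OF additive_h] del: D.simps)
  qed
qed

text \<open>Cells \<open>x^m Bot\<close> with \<open>m\<close> outside \<open>M\<close> are
  excluded: both \<open>h\<close> and \<open>bdry\<close> vanish there, and these cells represent
  \<open>S/I\<close> in homology.\<close>

lemma homotopy: "v \<in> supported (\<lambda>m l. valid l \<and> (l = Bot \<longrightarrow> m \<in> M)) \<Longrightarrow> bdry (h v) + h (bdry v) = v"
  unfolding homotopic_def[symmetric]
proof (rule homotopic_supported, assumption)
  fix m and l :: "'n label" assume l: "valid l \<and> (l = Bot \<longrightarrow> m \<in> M)"
  show "homotopic (cell m l)"
  proof (cases l)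
    case Bot
    then show ?thesis using l by (simp add: homotopic_Bot)
  next
    case (Lab p u)
    then show ?thesis using l bdry_D by (auto intro: homotopic_Lab[of "level l"])
  qed
qed

lemma bdry_bdry: "v \<in> supported (\<lambda>m l. valid l) \<Longrightarrow> bdry (bdry v) = 0"
  by (induction rule: supported_induct)
    (simp_all add: additive.zero[OF additive_bdry] bdry_add bdry_single bdry_fscale bdry_D)

lemma hc_Dcell: "valid l \<Longrightarrow> hc m l \<in> supported (Dcell (Suc (level l)) (mdeg m + ldeg l))"
proof (induction m l rule: hc.induct)
  case (1 m)
  have "mdeg (m - g m) + mdeg (g m) = mdeg m" if "m \<in> M"
    using g_props(3)[OF that] mdeg_add by metis
  then show ?case
    using g_props[of m] by (auto simp: hc.simps Dcell_def intro!: supported_monom_unit_vec)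
next
  case (2 m p u)
  show ?case
  proof (cases "keys m \<inter> N p u = {}")
    case False
    let ?i = "lead m p u"
    let ?R = "fscale (monom (m - xp ?i)) (R (?i # p) u)"
    have i: "?i \<in> N p u" "?i \<in> keys m" using lead_in[OF False] by auto
    then have v: "valid (Lab (?i # p) u)" using 2(2) by (simp only: valid_Cons)
    have deg: "mdeg m = Suc (mdeg (m - xp ?i))"
      using arg_cong[OF diff_xp_add[OF i(2)], of mdeg] by simp
    have R: "?R \<in> supported (Dcell (Suc (length p)) (mdeg m + ldeg (Lab p u)))"
      by (rule supported_monom[OF R_supported[OF v]])
        (auto simp: Rcell_def Dcell_def deg simp del: valid.simps)
    have "cell_ext hc ?R \<in> supported (Dcell (Suc (level (Lab p u))) (mdeg m + ldeg (Lab p u)))"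
      unfolding cell_ext_def
    proof (intro supported_sum supported_const)
      fix l s assume *: "l \<in> keys ?R" "s \<in> keys (lookup ?R l)"
      then have "valid l" "level l = level (Lab p u)" "mdeg s + ldeg l = mdeg m + ldeg (Lab p u)"
        using supportedD[OF R] by (auto simp: in_keys_iff Dcell_def)
      with 2(1)[OF _ *] 2(2) False
      show "hc s l \<in> supported (Dcell (Suc (level (Lab p u))) (mdeg m + ldeg (Lab p u)))"
        by auto
    qed
    then show ?thesis
      using 2(2) False v
      by (subst hc.simps) (auto intro!: supported_diff supported_monom_unit_vec
        simp: Dcell_def deg simp del: valid.simps)
  qed (simp add: hc.simps)
qed

end

section \<open>The product\<close>

lemma fscale_hom_eqI:
  assumes "module_hom fscale s F1" "module_hom fscale s F2"
    and "x \<in> supported Q" "\<And>m l. Q m l \<Longrightarrow> F1 (unit_vec l) = F2 (unit_vec l)"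
  shows "F1 x = F2 x"
proof -
  interpret F1: module_hom fscale s F1 by fact
  interpret F2: module_hom fscale s F2 by fact
  show ?thesis
    using assms(3)
  proof (induction rule: supported_induct)
    case zero
    then show ?case by (simp add: F1.zero F2.zero)
  next
    case (add x y)
    then show ?case by (simp add: F1.add F2.add)
  next
    case (cell m l a)
    have "single l (single m a) = fscale (single m a) (unit_vec l)"
      by (simp add: fscale_single)
    then show ?case using assms(4)[OF cell] by (simp only: F1.scale F2.scale)
  qed
qed

lemma fscale_homI:
  assumes "\<And>x y. F (x + y) = F x + F y" "\<And>a x. F (fscale a x) = fscale a (F x)"
  shows "module_hom fscale fscale F"
  by unfold_locales (use assms in auto)

context regular_decomposition
begin

section \<open>Active variables of products\<close>

definition Wcell :: "'n set \<Rightarrow> nat \<Rightarrow> ('n \<Rightarrow>\<^sub>0 nat) \<Rightarrow> 'n label \<Rightarrow> bool" where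
  "Wcell X n m l \<longleftrightarrow> (\<exists>p u. l = Lab p u \<and> valid l \<and> keys m \<inter> N p u = {} \<and>
     N p u \<subseteq> X \<and> level l = n)"

lemma Wcell_Bcell: "v \<in> supported (Wcell X n) \<Longrightarrow> v \<in> supported Bcell"
  by (erule supported_mono) (auto simp: Wcell_def Bcell_def)

lemma Wcell_mono: "v \<in> supported (Wcell X n) \<Longrightarrow> X \<subseteq> Y \<Longrightarrow> v \<in> supported (Wcell Y n)"
  by (erule supported_mono) (auto simp: Wcell_def)

text \<open>The reason for recording \<open>X\<close>: a monomial that avoids \<open>X\<close> is
  inactive for every cell with active set inside \<open>X\<close>. Membership in
  \<open>Bcell\<close> alone gives no such control over multiples.\<close>

lemma monom_Wcell:
  "v \<in> supported (Wcell X n) \<Longrightarrow> keys t \<inter> X = {} \<Longrightarrow>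
    fscale (monom t) v \<in> supported (Wcell X n)"
  by (erule supported_monom) (unfold Wcell_def keys_add_nat, blast)

lemma Aop_Wcell:
  "v \<in> supported (Wcell X n) \<Longrightarrow> Aop i v \<in> supported (Wcell {j \<in> X. j < i} (Suc n))"
  by (erule Aop_supported) (auto simp: Wcell_def N_Cons valid_Cons simp del: valid.simps)

text \<open>Generalizes \<open>hc_generator\<close> so that it passes through the recursion of
  \<open>hc\<close>: \<open>t\<close> is the part of \<open>u\<close> not yet used, \<open>z\<close>
  the used part, and \<open>s\<close> collects inactive factors coming from \<open>R\<close>. In the
  matroidal case, variables of \<open>u\<close> that are used up have to remain inactive.\<close>

lemma hc_generator_aux:
  assumes "u \<in> G" "u = t + z" "valid (Lab q w)" "keys s \<inter> N q w = {}"
    and "\<And>i. sep \<Longrightarrow> i \<in> keys u \<Longrightarrow> i \<notin> keys t \<Longrightarrow> i \<notin> N q w"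
  shows "hc (t + s) (Lab q w) \<in> supported (Wcell (st u \<inter> N q w) (Suc (Suc (length q))))"
  using assms(2-)
proof (induction "mdeg t" arbitrary: t z q w s)
  case 0
  then have "Bcell (t + s) (Lab q w)" by (simp add: Bcell_def)
  then show ?case by (simp add: hc_Bcell)
next
  case (Suc n)
  show ?case
  proof (cases "keys t \<inter> N q w = {}")
    case True
    then have "Bcell (t + s) (Lab q w)" using Suc.prems by (auto simp: Bcell_def)
    then show ?thesis by (simp add: hc_Bcell)
  next
    case False
    define i where "i = lead t q w"
    define t' where "t' = t - xp i"
    have i: "i \<in> N q w" "i \<in> keys t" using lead_in[OF False] by (simp_all add: i_def)
    have t: "t = xp i + t'" using diff_xp_add[OF i(2)] by (simp add: t'_def add.commute)
    have min: "i \<le> j" if "j \<in> keys t" "j \<in> N q w" for j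
      using lead_le[OF that] by (simp add: i_def)
    have v: "valid (Lab (i # q) w)" using Suc.prems(2) i by (simp only: valid_Cons)
    have dis: "keys (t' + s) \<inter> {j \<in> N q w. j < i} = {}"
      using min Suc.prems(3) by (auto simp: t not_less[symmetric])
    have sub: "{j \<in> N q w. j < i} \<subseteq> st u"
    proof (rule ccontr)
      assume "\<not> ?thesis"
      then obtain j where j: "j \<in> N q w" "j < i" "j \<notin> st u" by auto
      have iu: "i \<in> keys u" using i Suc.prems(1) by simp
      show False
      proof (cases sep)
        case False
        then show False using st_initial[OF False assms(1) j(3) iu] j by auto
      next
        case True
        obtain k where k: "k \<in> keys u" "k \<in> st w" "k \<le> j"
          using st_exchange[OF True assms(1), of w j] j Suc.prems(2) N_subset[of q w] by auto
        have "k \<in> N q w" using k j by (auto simp: N_def)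
        then show False using Suc.prems(4)[OF True k(1)] min[of k] k j by force
      qed
    qed
    let ?W = "Wcell (st u \<inter> N q w) (Suc (Suc (length q)))"
    let ?R = "fscale (monom (t' + s)) (R (i # q) w)"
    have "h ?R \<in> supported ?W"
    proof (rule additive_supported[OF additive_h])
      show "?R \<in> supported (\<lambda>m l. \<exists>r. m = t' + s + r \<and> Rcell i q w r l)"
        by (rule supported_monom[OF R_supported[OF v]]) auto
      fix m l and a :: 'k
      assume "\<exists>r. m = t' + s + r \<and> Rcell i q w r l"
      then obtain r where r: "m = t' + (s + r)" "Rcell i q w r l" by (auto simp: add.assoc)
      then obtain q' w' where l: "l = Lab q' w'" "valid (Lab q' w')" "length q' = length q"
        "keys r \<inter> N q' w' = {}" "N q' w' \<subseteq> N q w" "sep \<Longrightarrow> i \<notin> N q' w'"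
        by (auto simp: Rcell_def)
      have "hc (t' + (s + r)) (Lab q' w') \<in> supported (Wcell (st u \<inter> N q' w') (Suc (Suc (length q'))))"
      proof (rule Suc.hyps(1))
        show "n = mdeg t'" using Suc.hyps(2) by (simp add: t)
        show "u = t' + (xp i + z)" using Suc.prems(1) by (simp add: t algebra_simps)
        show "keys (s + r) \<inter> N q' w' = {}" using l Suc.prems(3) by auto
        fix k assume "sep" "k \<in> keys u" "k \<notin> keys t'"
        then show "k \<notin> N q' w'"
          using l Suc.prems(4)[of k] by (cases "k = i") (auto simp: t)
      qed (rule l)
      then have "hc m l \<in> supported ?W"
        unfolding r(1) l(1,3) by (rule Wcell_mono) (use l in auto)
      then show "h (single l (single m a)) \<in> supported ?W"
        by (simp add: h_single supported_const)
    qed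
    moreover have "cell (t' + s) (Lab (i # q) w) \<in> supported ?W"
      using v dis sub by (intro supported_monom_unit_vec) (auto simp: Wcell_def N_Cons simp del: valid.simps)
    ultimately show ?thesis
      unfolding t add.assoc hc_lead[OF Suc.prems(2) i(1) dis] by (rule supported_diff[rotated])
  qed
qed

lemma hc_generator:
  "u \<in> G \<Longrightarrow> valid (Lab q w) \<Longrightarrow> hc u (Lab q w) \<in> supported (Wcell (st u \<inter> N q w) (Suc (Suc (length q))))"
  using hc_generator_aux[of u u 0 q w 0] by simp

text \<open>This is \<open>h (d a b \<plusminus> a d b)\<close> for \<open>a = Lab p u\<close>, \<open>b = Lab q v\<close>, see \<open>P_eq_h\<close>: the terms coming
  from \<open>R\<close> are killed by \<open>h\<close>, so that only the leading terms of \<open>d a\<close> and \<open>d b\<close> remain.\<close>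

fun pr :: "'n list \<Rightarrow> ('n \<Rightarrow>\<^sub>0 nat) \<Rightarrow> 'n list \<Rightarrow> ('n \<Rightarrow>\<^sub>0 nat) \<Rightarrow> 'n label \<Rightarrow>\<^sub>0 ('n, 'k) mpoly" where
  "pr p u q v =
     (case p of [] \<Rightarrow> hc u (Lab q v) | i # p' \<Rightarrow> Aop i (pr p' u q v)) +
     fscale ((-1) ^ Suc (length p)) (case q of [] \<Rightarrow> hc v (Lab p u) | j # q' \<Rightarrow> Aop j (pr p u q' v))"

declare pr.simps [simp del]

text \<open>At the ends of the recursion \<open>hc_generator\<close> bounds the active variables by
  both factors. Prepending \<open>i\<close> leaves only those below \<open>i\<close>, which is
  exactly how \<open>N\<close> changes from \<open>p'\<close> to \<open>i # p'\<close>.\<close>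

lemma pr_supported:
  "valid (Lab p u) \<Longrightarrow> valid (Lab q v) \<Longrightarrow>
    pr p u q v \<in> supported (Wcell (N p u \<inter> N q v) (Suc (Suc (length p + length q))))"
proof (induction p u q v rule: pr.induct)
  case (1 p u q v)
  show ?case
  proof (subst pr.simps, intro supported_add supported_sign)
    show "(case p of [] \<Rightarrow> hc u (Lab q v) | i # p' \<Rightarrow> Aop i (pr p' u q v)) \<in>
      supported (Wcell (N p u \<inter> N q v) (Suc (Suc (length p + length q))))"
    proof (cases p)
      case Nil
      then show ?thesis using hc_generator[of u q v] "1.prems" by simp
    next
      case (Cons i p')
      have v: "valid (Lab p' u)" using "1.prems"(1) unfolding Cons valid_Cons by blast
      show ?thesis
        using Aop_Wcell[OF "1.IH"(1)[OF Cons v "1.prems"(2)], of i] unfolding Cons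
        by simp (erule Wcell_mono, auto simp: N_Cons)
    qed
    show "(case q of [] \<Rightarrow> hc v (Lab p u) | j # q' \<Rightarrow> Aop j (pr p u q' v)) \<in>
      supported (Wcell (N p u \<inter> N q v) (Suc (Suc (length p + length q))))"
    proof (cases q)
      case Nil
      then show ?thesis using hc_generator[of v p u] "1.prems" by (simp add: Int_commute)
    next
      case (Cons j q')
      have v: "valid (Lab q' v)" using "1.prems"(2) unfolding Cons valid_Cons by blast
      show ?thesis
        using Aop_Wcell[OF "1.IH"(2)[OF Cons "1.prems"(1) v], of j] unfolding Cons
        by simp (erule Wcell_mono, auto simp: N_Cons)
    qed
  qed
qed

lemma Aop_sign: "Aop i (fscale ((-1) ^ n) v) = fscale ((-1) ^ n) (Aop i v)"
  by (rule additive_sign[OF additive_Aop])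

lemma pr_commute:
  "pr p u q v = fscale ((-1) ^ (Suc (length p) * Suc (length q))) (pr q v p u)"
proof (induction p u q v rule: pr.induct)
  case (1 p u q v)
  let ?X = "case p of [] \<Rightarrow> hc u (Lab q v) | i # p' \<Rightarrow> Aop i (pr q v p' u)"
  let ?Y = "case q of [] \<Rightarrow> hc v (Lab p u) | j # q' \<Rightarrow> Aop j (pr q' v p u)"
  have X: "(case p of [] \<Rightarrow> hc u (Lab q v) | i # p' \<Rightarrow> Aop i (pr p' u q v)) =
      fscale ((-1) ^ (length p * Suc (length q))) ?X"
    using "1.IH"(1) by (auto split: list.split simp: Aop_sign simp del: power_Suc)
  have Y: "(case q of [] \<Rightarrow> hc v (Lab p u) | j # q' \<Rightarrow> Aop j (pr p u q' v)) =
      fscale ((-1) ^ (Suc (length p) * length q)) ?Y"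
    using "1.IH"(2) by (auto split: list.split simp: Aop_sign ac_simps simp del: power_Suc)
  show ?case
    unfolding pr.simps[of p u q v] pr.simps[of q v p u] X Y
    by (cases "even (length p)"; cases "even (length q)"; simp add: free.scale_right_distrib)
qed

section \<open>Bilinear extension, unit and graded commutativity\<close>

definition P :: "'n label \<Rightarrow> 'n label \<Rightarrow> 'n label \<Rightarrow>\<^sub>0 ('n, 'k) mpoly" where
  "P a b = (case a of Bot \<Rightarrow> unit_vec b | Lab p u \<Rightarrow>
     (case b of Bot \<Rightarrow> unit_vec a | Lab q v \<Rightarrow> pr p u q v))"

lemma P_simps [simp]: "P Bot b = unit_vec b" "P a Bot = unit_vec a" "P (Lab p u) (Lab q v) = pr p u q v"
  by (auto simp: P_def split: label.split)

definition mu where "mu x y = slin (\<lambda>a. slin (P a) y) x"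

lemma mu_add_left: "mu (x + y) z = mu x z + mu y z"
  by (simp add: mu_def free.lin_ext_add)

lemma mu_fscale_left: "mu (fscale a x) z = fscale a (mu x z)"
  by (simp add: mu_def free.lin_ext_fscale)

lemma mu_add_right: "mu z (x + y) = mu z x + mu z y"
  by (simp add: mu_def free.lin_ext_def[of _ z] free.lin_ext_add free.scale_right_distrib sum.distrib)

lemma mu_fscale_right: "mu z (fscale a x) = fscale a (mu z x)"
  by (simp add: mu_def free.lin_ext_def[of _ z] free.lin_ext_fscale free.scale_sum_right mult.commute)

lemma mu_hom_left: "module_hom fscale fscale (\<lambda>x. mu x y)"
  by (rule fscale_homI) (simp_all add: mu_add_left mu_fscale_left)

lemma mu_hom_right: "module_hom fscale fscale (mu x)"
  by (rule fscale_homI) (simp_all add: mu_add_right mu_fscale_right)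

lemma mu_zero [simp]: "mu 0 x = 0" "mu x 0 = 0"
  using module_hom.zero[OF mu_hom_left] module_hom.zero[OF mu_hom_right] by auto

lemma mu_unit_vec [simp]: "mu (unit_vec a) (unit_vec b) = P a b"
  by (simp add: mu_def)

lemma mu_left_unit_vec: "mu x (unit_vec b) = slin (\<lambda>a. P a b) x"
  by (simp add: mu_def)

lemma mu_right_unit_vec: "mu (unit_vec a) x = slin (P a) x"
  by (simp add: mu_def)

lemma mu_Bot_left: "mu (unit_vec Bot) x = x"
  by (simp add: mu_right_unit_vec P_def[abs_def] slin_unit_vec)

lemma mu_Bot_right: "mu x (unit_vec Bot) = x"
  by (simp add: mu_left_unit_vec slin_unit_vec)

definition graded :: "nat \<Rightarrow> ('n label \<Rightarrow>\<^sub>0 ('n, 'k) mpoly) set" where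
  "graded n = supported (\<lambda>m l. valid l \<and> level l = n)"

lemma P_graded: "valid a \<Longrightarrow> valid b \<Longrightarrow> P a b \<in> graded (level a + level b)"
  unfolding graded_def
  by (cases a; cases b)
    (auto simp: Wcell_def simp del: valid.simps intro!: supported_unit_vec
      intro: supported_mono[OF pr_supported])

lemma mu_graded:
  assumes "x \<in> graded n" "y \<in> graded k"
  shows "mu x y \<in> graded (n + k)"
proof -
  have *: "slin (P a) y \<in> graded (n + k)" if "valid a" "level a = n" for a
    using assms(2) unfolding graded_def
    by (rule slin_supported)
      (use P_graded[OF that(1)] that in \<open>auto simp: graded_def intro!: supported_monom\<close>)
  show ?thesis
    using assms(1) unfolding graded_def mu_def
    by (rule slin_supported) (use * in \<open>auto simp: graded_def intro!: supported_monom\<close>)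
qed

lemma mu_commute:
  assumes "x \<in> graded n" "y \<in> graded k"
  shows "mu x y = fscale ((-1) ^ (n * k)) (mu y x)"
  using assms(1) unfolding graded_def
proof (rule fscale_hom_eqI[rotated 2])
  show "module_hom fscale fscale (\<lambda>x. mu x y)" by (rule mu_hom_left)
  show "module_hom fscale fscale (\<lambda>x. fscale ((-1) ^ (n * k)) (mu y x))"
    by (rule fscale_homI) (simp_all add: mu_add_right mu_fscale_right free.scale_right_distrib mult.commute)
  fix m a assume a: "valid a \<and> level a = n"
  show "mu (unit_vec a) y = fscale ((-1) ^ (n * k)) (mu y (unit_vec a))"
    using assms(2) unfolding graded_def
  proof (rule fscale_hom_eqI[rotated 2])
    show "module_hom fscale fscale (\<lambda>y. fscale ((-1) ^ (n * k)) (mu y (unit_vec a)))"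
      by (rule fscale_homI) (simp_all add: mu_add_left mu_fscale_left free.scale_right_distrib mult.commute)
    fix m b assume b: "valid b \<and> level b = k"
    show "mu (unit_vec a) (unit_vec b) = fscale ((-1) ^ (n * k)) (mu (unit_vec b) (unit_vec a))"
    proof (cases a; cases b)
      fix p u q v assume "a = Lab p u" "b = Lab q v"
      then show ?thesis using a b pr_commute[of p u q v] by auto
    qed (use a b in auto)
  qed (rule mu_hom_right)
qed

section \<open>The Leibniz rule\<close>

lemma h_sign: "h (fscale ((-1) ^ n) v) = fscale ((-1) ^ n) (h v)"
  by (rule additive_sign[OF additive_h])

text \<open>A term \<open>x^m l\<close> of \<open>R (i # p') u\<close> is inactive, and its product
  with \<open>Lab q v\<close> has no active variables beyond those of \<open>l\<close>, so
  \<open>h\<close> kills it. On the remaining term \<open>x_i (Lab p' u)\<close> the contraction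
  acts as \<open>Aop i\<close>.\<close>

lemma h_mu_D_left:
  assumes "valid (Lab p u)" "valid (Lab q v)"
  shows "h (mu (D (Lab p u)) (unit_vec (Lab q v))) =
    (case p of [] \<Rightarrow> hc u (Lab q v) | i # p' \<Rightarrow> Aop i (pr p' u q v))"
proof (cases p)
  case Nil
  then show ?thesis by (simp add: mu_fscale_left h_cell)
next
  case (Cons i p')
  have v: "valid (Lab (i # p') u)" "valid (Lab p' u)" using assms(1) unfolding Cons valid_Cons by auto
  have "mu (R (i # p') u) (unit_vec (Lab q v)) \<in> supported Bcell"
    unfolding mu_left_unit_vec
  proof (rule slin_supported[OF R_supported[OF v(1)]])
    fix m l assume "Rcell i p' u m l"
    then obtain r w where l: "l = Lab r w" "valid (Lab r w)" "keys m \<inter> N r w = {}"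
      by (auto simp: Rcell_def)
    have "fscale (monom m) (pr r w q v) \<in> supported (Wcell (N r w \<inter> N q v) (Suc (Suc (length r + length q))))"
      using l by (intro monom_Wcell pr_supported assms) auto
    then show "fscale (monom m) (P l (Lab q v)) \<in> supported Bcell"
      unfolding l(1) P_simps by (rule Wcell_Bcell)
  qed
  then have "h (mu (R (i # p') u) (unit_vec (Lab q v))) = 0" by (rule h_Bcell)
  moreover have "h (fscale (monom (xp i)) (pr p' u q v)) = Aop i (pr p' u q v)"
    by (rule h_xp_Bcell[OF Wcell_Bcell[OF pr_supported[OF v(2) assms(2)]]])
  ultimately show ?thesis
    by (simp add: Cons mu_add_left mu_fscale_left additive.add[OF additive_h])
qed

lemma h_mu_D_right:
  assumes "valid (Lab p u)" "valid (Lab q v)"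
  shows "h (mu (unit_vec (Lab p u)) (D (Lab q v))) =
    (case q of [] \<Rightarrow> hc v (Lab p u) | j # q' \<Rightarrow> Aop j (pr p u q' v))"
proof (cases q)
  case Nil
  then show ?thesis by (simp add: mu_fscale_right h_cell)
next
  case (Cons j q')
  have v: "valid (Lab (j # q') v)" "valid (Lab q' v)" using assms(2) unfolding Cons valid_Cons by auto
  have "mu (unit_vec (Lab p u)) (R (j # q') v) \<in> supported Bcell"
    unfolding mu_right_unit_vec
  proof (rule slin_supported[OF R_supported[OF v(1)]])
    fix m l assume "Rcell j q' v m l"
    then obtain r w where l: "l = Lab r w" "valid (Lab r w)" "keys m \<inter> N r w = {}"
      by (auto simp: Rcell_def)
    have "fscale (monom m) (pr p u r w) \<in> supported (Wcell (N p u \<inter> N r w) (Suc (Suc (length p + length r))))"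
      using l by (intro monom_Wcell pr_supported assms) auto
    then show "fscale (monom m) (P (Lab p u) l) \<in> supported Bcell"
      unfolding l(1) P_simps by (rule Wcell_Bcell)
  qed
  then have "h (mu (unit_vec (Lab p u)) (R (j # q') v)) = 0" by (rule h_Bcell)
  moreover have "h (fscale (monom (xp j)) (pr p u q' v)) = Aop j (pr p u q' v)"
    by (rule h_xp_Bcell[OF Wcell_Bcell[OF pr_supported[OF assms(1) v(2)]]])
  ultimately show ?thesis
    by (simp add: Cons mu_add_right mu_fscale_right additive.add[OF additive_h])
qed

lemma P_eq_h:
  assumes "valid (Lab p u)" "valid (Lab q v)"
  shows "P (Lab p u) (Lab q v) = h (mu (D (Lab p u)) (unit_vec (Lab q v)) +
    fscale ((-1) ^ level (Lab p u)) (mu (unit_vec (Lab p u)) (D (Lab q v))))"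
  unfolding additive.add[OF additive_h] h_sign h_mu_D_left[OF assms] h_mu_D_right[OF assms]
  by (simp add: pr.simps[of p u q v] del: power_Suc)

lemma graded_D: "valid (Lab p u) \<Longrightarrow> D (Lab p u) \<in> graded (length p)"
  unfolding graded_def by (rule supported_mono[OF D_supported]) (auto simp: Dcell_def)

lemma graded_unit_vec: "valid l \<Longrightarrow> unit_vec l \<in> graded (level l)"
  by (simp add: graded_def supported_unit_vec)

lemma homotopy_graded: "v \<in> graded (Suc n) \<Longrightarrow> bdry (h v) + h (bdry v) = v"
  unfolding graded_def by (rule homotopy, erule supported_mono) auto

lemma leibniz_ext:
  assumes lab: "\<And>a b. valid a \<Longrightarrow> valid b \<Longrightarrow> level a = n \<Longrightarrow> level b = k \<Longrightarrow>
      bdry (P a b) = mu (D a) (unit_vec b) + fscale ((-1) ^ n) (mu (unit_vec a) (D b))"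
    and x: "x \<in> graded n" and y: "y \<in> graded k"
  shows "bdry (mu x y) = mu (bdry x) y + fscale ((-1) ^ n) (mu x (bdry y))"
  using x unfolding graded_def
proof (rule fscale_hom_eqI[rotated 2])
  show "module_hom fscale fscale (\<lambda>x. bdry (mu x y))"
    "module_hom fscale fscale (\<lambda>x. mu (bdry x) y + fscale ((-1) ^ n) (mu x (bdry y)))"
    by (rule fscale_homI; simp add: mu_add_left mu_fscale_left bdry_add bdry_fscale
        free.scale_right_distrib mult.commute)+
  fix m a assume a: "valid a \<and> level a = n"
  show "bdry (mu (unit_vec a) y) = mu (bdry (unit_vec a)) y + fscale ((-1) ^ n) (mu (unit_vec a) (bdry y))"
    using y unfolding graded_def
  proof (rule fscale_hom_eqI[rotated 2])
    show "module_hom fscale fscale (\<lambda>y. bdry (mu (unit_vec a) y))"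
      "module_hom fscale fscale (\<lambda>y. mu (bdry (unit_vec a)) y + fscale ((-1) ^ n) (mu (unit_vec a) (bdry y)))"
      by (rule fscale_homI; simp add: mu_add_right mu_fscale_right bdry_add bdry_fscale
          free.scale_right_distrib mult.commute)+
    fix m b assume "valid b \<and> level b = k"
    with a lab show "bdry (mu (unit_vec a) (unit_vec b)) =
      mu (bdry (unit_vec a)) (unit_vec b) + fscale ((-1) ^ n) (mu (unit_vec a) (bdry (unit_vec b)))"
      by simp
  qed
qed

lemma leibniz_P:
  "valid a \<Longrightarrow> valid b \<Longrightarrow>
    bdry (P a b) = mu (D a) (unit_vec b) + fscale ((-1) ^ level a) (mu (unit_vec a) (D b))"
proof (induction "level a + level b" arbitrary: a b rule: less_induct)
  case less
  have IH: "bdry (mu x y) = mu (bdry x) y + fscale ((-1) ^ n) (mu x (bdry y))"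
    if "x \<in> graded n" "y \<in> graded k" "n + k < level a + level b" for x y n k
    by (rule leibniz_ext[OF _ that(1,2)]) (use less.hyps that(3) in auto)
  show ?case
  proof (cases a)
    case Bot
    then show ?thesis by (simp add: mu_Bot_left)
  next
    case a: (Lab p u)
    show ?thesis
    proof (cases b)
      case Bot
      then show ?thesis by (simp add: mu_Bot_right)
    next
      case b: (Lab q v)
      note val = less.prems[unfolded a b]
      let ?y1 = "mu (D (Lab p u)) (unit_vec (Lab q v))" and ?y2 = "mu (unit_vec (Lab p u)) (D (Lab q v))"
      let ?y = "?y1 + fscale ((-1) ^ level (Lab p u)) ?y2"
      have 1: "bdry ?y1 = mu (bdry (D (Lab p u))) (unit_vec (Lab q v)) +
          fscale ((-1) ^ length p) (mu (D (Lab p u)) (bdry (unit_vec (Lab q v))))"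
        by (rule IH) (use graded_D[OF val(1)] graded_unit_vec[OF val(2)] in \<open>auto simp: a b\<close>)
      have 2: "bdry ?y2 = mu (bdry (unit_vec (Lab p u))) (D (Lab q v)) +
          fscale ((-1) ^ level (Lab p u)) (mu (unit_vec (Lab p u)) (bdry (D (Lab q v))))"
        by (rule IH) (use graded_D[OF val(2)] graded_unit_vec[OF val(1)] in \<open>auto simp: a b\<close>)
      \<comment> \<open>The two terms \<open>d a * d b\<close> have opposite signs, since
        \<open>d a\<close> has degree one less than \<open>a\<close>.\<close>
      have "bdry ?y = 0"
        by (simp add: bdry_add additive.diff[OF additive_bdry] bdry_fscale 1 2 bdry_D val del: valid.simps D.simps)
      \<comment> \<open>Both factors have positive level, so \<open>?y\<close> avoids level 0, where
        the homotopy identity would require membership in the ideal.\<close>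
      moreover have "?y \<in> graded (Suc (length p + length q))"
        using mu_graded[OF graded_D[OF val(1)] graded_unit_vec[OF val(2)]]
          mu_graded[OF graded_unit_vec[OF val(1)] graded_D[OF val(2)]]
        unfolding graded_def by (intro supported_add supported_sign) simp_all
      ultimately have "bdry (h ?y) = ?y"
        using homotopy_graded[of ?y] by (simp add: additive.zero[OF additive_h])
      then show ?thesis by (simp only: a b P_eq_h[OF val])
    qed
  qed
qed

lemma leibniz_mu:
  "x \<in> graded n \<Longrightarrow> y \<in> graded k \<Longrightarrow> bdry (mu x y) = mu (bdry x) y + fscale ((-1) ^ n) (mu x (bdry y))"
  by (rule leibniz_ext) (auto simp: leibniz_P)

section \<open>Associativity\<close>

lemma assoc_ext:
  assumes lab: "\<And>a b c. Qa a \<Longrightarrow> Qb b \<Longrightarrow> Qc c \<Longrightarrow>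
      mu (P a b) (unit_vec c) = mu (unit_vec a) (P b c)"
    and x: "x \<in> supported (\<lambda>_. Qa)" and y: "y \<in> supported (\<lambda>_. Qb)" and z: "z \<in> supported (\<lambda>_. Qc)"
  shows "mu (mu x y) z = mu x (mu y z)"
  using x
proof (rule fscale_hom_eqI[rotated 2])
  fix a assume a: "Qa a"
  show "mu (mu (unit_vec a) y) z = mu (unit_vec a) (mu y z)"
    using y
  proof (rule fscale_hom_eqI[rotated 2])
    fix b assume b: "Qb b"
    show "mu (mu (unit_vec a) (unit_vec b)) z = mu (unit_vec a) (mu (unit_vec b) z)"
      using z by (rule fscale_hom_eqI[rotated 2])
        (auto intro!: fscale_homI simp: mu_add_right mu_fscale_right lab[OF a b])
  qed (auto intro!: fscale_homI simp: mu_add_right mu_fscale_right mu_add_left mu_fscale_left)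
qed (auto intro!: fscale_homI simp: mu_add_left mu_fscale_left)

lemma assoc_P:
  "valid a \<Longrightarrow> valid b \<Longrightarrow> valid c \<Longrightarrow> mu (P a b) (unit_vec c) = mu (unit_vec a) (P b c)"
proof (induction "level a + level b + level c" arbitrary: a b c rule: less_induct)
  case less
  have IH: "mu (mu x y) z = mu x (mu y z)"
    if "x \<in> graded i" "y \<in> graded j" "z \<in> graded k" "i + j + k < level a + level b + level c"
    for x y z i j k
    by (rule assoc_ext[OF less.hyps, of "\<lambda>l. valid l \<and> level l = i" "\<lambda>l. valid l \<and> level l = j"
          "\<lambda>l. valid l \<and> level l = k"]) (use that in \<open>auto simp: graded_def\<close>)
  show ?case
  proof (cases "a = Bot \<or> b = Bot \<or> c = Bot")
    case True
    then show ?thesis by (auto simp: mu_Bot_left mu_Bot_right)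
  next
    case False
    then obtain p u q v r w where abc: "a = Lab p u" "b = Lab q v" "c = Lab r w"
      by (metis label.exhaust)
    note val = less.prems[unfolded abc]
    note gr = graded_unit_vec[OF val(1)] graded_unit_vec[OF val(2)] graded_unit_vec[OF val(3)]
    note grD = graded_D[OF val(1)] graded_D[OF val(2)] graded_D[OF val(3)]
    let ?a = "unit_vec a" and ?b = "unit_vec b" and ?c = "unit_vec c"
    let ?L = "mu (P a b) ?c" and ?T = "mu ?a (P b c)"
    \<comment> \<open>For a term \<open>x^m l\<close> of \<open>P a b\<close>, the monomial
      \<open>x^m\<close> avoids the active set of \<open>l\<close> and therefore the active sets of
      all terms of \<open>P l c\<close>.\<close>
    have L: "?L \<in> supported Bcell"
      unfolding mu_left_unit_vec
    proof (rule slin_supported)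
      show "P a b \<in> supported (Wcell (N p u \<inter> N q v) (Suc (Suc (length p + length q))))"
        unfolding abc P_simps by (rule pr_supported[OF val(1,2)])
      fix m l assume "Wcell (N p u \<inter> N q v) (Suc (Suc (length p + length q))) m l"
      then obtain p' u' where l: "l = Lab p' u'" "valid (Lab p' u')" "keys m \<inter> N p' u' = {}"
        by (auto simp: Wcell_def)
      have "fscale (monom m) (pr p' u' r w) \<in>
          supported (Wcell (N p' u' \<inter> N r w) (Suc (Suc (length p' + length r))))"
        using l by (intro monom_Wcell pr_supported val) auto
      then show "fscale (monom m) (P l c) \<in> supported Bcell"
        unfolding l(1) abc P_simps by (rule Wcell_Bcell)
    qed
    have T: "?T \<in> supported Bcell"
      unfolding mu_right_unit_vec
    proof (rule slin_supported)
      show "P b c \<in> supported (Wcell (N q v \<inter> N r w) (Suc (Suc (length q + length r))))"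
        unfolding abc P_simps by (rule pr_supported[OF val(2,3)])
      fix m l assume "Wcell (N q v \<inter> N r w) (Suc (Suc (length q + length r))) m l"
      then obtain p' u' where l: "l = Lab p' u'" "valid (Lab p' u')" "keys m \<inter> N p' u' = {}"
        by (auto simp: Wcell_def)
      have "fscale (monom m) (pr p u p' u') \<in>
          supported (Wcell (N p u \<inter> N p' u') (Suc (Suc (length p + length p'))))"
        using l by (intro monom_Wcell pr_supported val) auto
      then show "fscale (monom m) (P a l) \<in> supported Bcell"
        unfolding l(1) abc P_simps by (rule Wcell_Bcell)
    qed
    have g: "P a b \<in> graded (level a + level b)" "P b c \<in> graded (level b + level c)"
      using P_graded less.prems by auto
    have "bdry ?L = mu (bdry (P a b)) ?c + fscale ((-1) ^ (level a + level b)) (mu (P a b) (D c))"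
      using leibniz_mu[OF g(1) graded_unit_vec[OF less.prems(3)]] by simp
    also have "\<dots> = mu (mu (D a) ?b) ?c + fscale ((-1) ^ level a) (mu (mu ?a (D b)) ?c) +
        fscale ((-1) ^ (level a + level b)) (mu (mu ?a ?b) (D c))"
      by (simp add: leibniz_P less.prems mu_add_left mu_fscale_left)
    also have "\<dots> = mu (D a) (mu ?b ?c) + fscale ((-1) ^ level a) (mu ?a (mu (D b) ?c)) +
        fscale ((-1) ^ (level a + level b)) (mu ?a (mu ?b (D c)))"
      using IH[OF grD(1) gr(2,3)] IH[OF gr(1) grD(2) gr(3)] IH[OF gr(1,2) grD(3)]
      by (simp add: abc del: mu_unit_vec D.simps)
    also have "\<dots> = mu (D a) (P b c) + fscale ((-1) ^ level a) (mu ?a (bdry (P b c)))"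
      by (simp add: leibniz_P less.prems mu_add_right mu_fscale_right free.scale_right_distrib power_add)
    also have "\<dots> = bdry ?T"
      using leibniz_mu[OF graded_unit_vec[OF less.prems(1)] g(2)] by simp
    finally have "bdry (?L - ?T) = 0" by (simp add: additive.diff[OF additive_bdry])
    moreover have "h (?L - ?T) = 0" by (intro h_Bcell supported_diff L T)
    \<comment> \<open>No cell in \<open>Bcell\<close> lies over \<open>Bot\<close>, so the side
      condition of \<open>homotopy\<close> is met.\<close>
    moreover have "bdry (h (?L - ?T)) + h (bdry (?L - ?T)) = ?L - ?T"
      by (rule homotopy, rule supported_mono[OF supported_diff[OF L T]]) (auto simp: Bcell_def)
    ultimately show ?thesis by (simp add: additive.zero[OF additive_bdry] additive.zero[OF additive_h])
  qed
qed

lemma assoc_mu: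
  "x \<in> supported (\<lambda>_. valid) \<Longrightarrow> y \<in> supported (\<lambda>_. valid) \<Longrightarrow> z \<in> supported (\<lambda>_. valid) \<Longrightarrow>
    mu (mu x y) z = mu x (mu y z)"
  by (rule assoc_ext[OF assoc_P])

end

section \<open>Comparison with an arbitrary minimal resolution\<close>

context regular_decomposition
begin

lemma mu_valid:
  assumes "x \<in> supported (\<lambda>_. valid)" "y \<in> supported (\<lambda>_. valid)"
  shows "mu x y \<in> supported (\<lambda>_. valid)"
  unfolding mu_def
proof (rule slin_supported[OF assms(1)], rule supported_monom)
  fix a assume a: "valid a"
  show "slin (P a) y \<in> supported (\<lambda>_. valid)"
    by (rule slin_supported[OF assms(2)], rule supported_monom,
        rule supported_mono[OF P_graded[OF a, unfolded graded_def]]) auto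
qed

text \<open>The sign depends only on the degree of \<open>x\<close>; accordingly a DGA structure
  demands the rule also for inhomogeneous \<open>y\<close>.\<close>

lemma leibniz_valid:
  assumes x: "x \<in> graded n" and y: "y \<in> supported (\<lambda>_. valid)"
  shows "bdry (mu x y) = mu (bdry x) y + fscale ((-1) ^ n) (mu x (bdry y))"
  using y
proof (rule fscale_hom_eqI[rotated 2])
  show "module_hom fscale fscale (\<lambda>y. bdry (mu x y))"
    "module_hom fscale fscale (\<lambda>y. mu (bdry x) y + fscale ((-1) ^ n) (mu x (bdry y)))"
    by (rule fscale_homI; simp add: mu_add_right mu_fscale_right bdry_add bdry_fscale
        free.scale_right_distrib mult.commute)+
qed (rule leibniz_mu[OF x graded_unit_vec])

lemma graded_valid: "v \<in> graded n \<Longrightarrow> v \<in> supported (\<lambda>_. valid)"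
  unfolding graded_def by (erule supported_mono) auto

lemma h_graded: "v \<in> graded n \<Longrightarrow> h v \<in> graded (Suc n)"
  unfolding graded_def
proof (rule additive_supported[OF additive_h], assumption)
  fix m l a assume l: "valid l \<and> level l = n"
  then have "hc m l \<in> supported (\<lambda>m l. valid l \<and> level l = Suc n)"
    by (intro supported_mono[OF hc_Dcell]) (auto simp: Dcell_def)
  then show "h (single l (single m a)) \<in> supported (\<lambda>m l. valid l \<and> level l = Suc n)"
    by (simp add: h_single supported_const)
qed

text \<open>The condition \<open>m \<noteq> 0\<close> is the minimality of the model; it makes the
  Nakayama argument in \<open>surj_at_Suc\<close> descend.\<close>

lemma bdry_graded:
  "v \<in> graded (Suc n) \<Longrightarrow> bdry v \<in> supported (\<lambda>m l. m \<noteq> 0 \<and> valid l \<and> level l = n)"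
  unfolding graded_def bdry_def
proof (rule slin_supported, assumption)
  fix m l assume "valid l \<and> level l = Suc n"
  then obtain p u where l: "l = Lab p u" "valid (Lab p u)" "n = length p" by (cases l) auto
  show "fscale (monom m) (D l) \<in> supported (\<lambda>m l. m \<noteq> 0 \<and> valid l \<and> level l = n)"
    unfolding l(1)
    by (rule supported_monom[OF D_supported[OF l(2)]])
      (auto simp: Dcell_def l(3) simp flip: mdeg_eq_0)
qed

section \<open>Internal degrees and orders of vanishing\<close>

definition component :: "int \<Rightarrow> ('n label \<Rightarrow>\<^sub>0 ('n, 'k) mpoly) \<Rightarrow> 'n label \<Rightarrow>\<^sub>0 ('n, 'k) mpoly" where
  "component j = cell_ext (\<lambda>m l. if int (mdeg m + ldeg l) = j then cell m l else 0)"

lemma additive_component: "additive (component j)"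
  unfolding component_def by (rule additive_cell_ext)

lemma component_homogeneous:
  assumes "v \<in> supported (\<lambda>m l. int (mdeg m + ldeg l) = i)"
  shows "component j v = (if i = j then v else 0)"
  using assms
proof (induction rule: supported_induct)
  case (cell m l a)
  then show ?case
    by (simp add: component_def cell_ext_single) (simp add: fscale_single monom_def mult_single)
qed (simp_all add: additive.zero[OF additive_component] additive.add[OF additive_component])

lemma component_supported:
  assumes "v \<in> supported Q"
  shows "component j v \<in> supported (\<lambda>m l. Q m l \<and> int (mdeg m + ldeg l) = j)"
  using assms
  by (rule additive_supported[OF additive_component])
    (auto simp: component_def cell_ext_single simp del: free.scale_scale
      intro!: supported_const supported_monom_unit_vec)

end

text \<open>This is the \<open>n\<close>-th power of the irrelevant ideal, described by the order of
  vanishing so that the intersection of all powers is visibly zero.\<close>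

definition vanishing :: "nat \<Rightarrow> ('n::finite, 'k::comm_ring_1) mpoly set" where
  "vanishing n = {f. \<forall>t\<in>keys f. n \<le> mdeg t}"

lemma vanishing_zero [simp]: "0 \<in> vanishing n"
  by (simp add: vanishing_def)

lemma vanishing_add: "f \<in> vanishing n \<Longrightarrow> g \<in> vanishing n \<Longrightarrow> f + g \<in> vanishing n"
  using keys_add[of f g] by (fastforce simp: vanishing_def)

lemma vanishing_sum: "(\<And>x. x \<in> A \<Longrightarrow> f x \<in> vanishing n) \<Longrightarrow> sum f A \<in> vanishing n"
  by (induction A rule: infinite_finite_induct) (auto intro: vanishing_add)

lemma vanishing_mult: "f \<in> vanishing n \<Longrightarrow> g \<in> vanishing k \<Longrightarrow> f * g \<in> vanishing (n + k)"
  using keys_mult[of f g] by (fastforce simp: vanishing_def intro: add_mono)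

lemma vanishing_0 [simp]: "f \<in> vanishing 0"
  by (simp add: vanishing_def)

lemma vanishing_all: "(\<And>n. f \<in> vanishing n) \<Longrightarrow> f = 0"
proof (rule ccontr)
  assume *: "\<And>n. f \<in> vanishing n" and "f \<noteq> 0"
  then obtain t where "t \<in> keys f" by (metis keys_eq_empty ex_in_conv)
  then show False using *[of "Suc (mdeg t)"] by (auto simp: vanishing_def)
qed

interpretation ring_module: module "(*) :: 'a::comm_ring_1 \<Rightarrow> 'a \<Rightarrow> 'a"
  by unfold_locales (auto simp: algebra_simps)

lemma irrelevant_vanishing: "f \<in> irrelevant_ideal \<Longrightarrow> f \<in> vanishing 1"
  unfolding irrelevant_ideal_def ideal_gen_def
proof (induction rule: ring_module.span_induct_alt)
  case (step c x y)
  then have "x \<in> vanishing 1" by (auto simp: vanishing_def monom_def)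
  then show ?case using vanishing_mult[of c 0 x 1] step by (auto intro: vanishing_add)
qed simp

context minimal_free_resolution
begin

abbreviation basis where "basis \<equiv> \<Union>p. B p"
abbreviation rep where "rep \<equiv> representation basis"

lemma in_span [simp]: "x \<in> span basis"
  by (simp add: span_basis)

lemma rep_vanishing:
  assumes "x \<in> span {scale f y | f y. f \<in> irrelevant_ideal}"
  shows "rep x b \<in> vanishing 1"
  using assms
proof (induction rule: span_induct_alt)
  case base
  then show ?case by (simp add: representation_zero)
next
  case (step c x y)
  then obtain f z where x: "x = scale f z" "f \<in> vanishing 1" using irrelevant_vanishing by blast
  have "rep (scale c x + y) b = (c * rep z b) * f + rep y b"
    by (simp add: x representation_add[OF independent_basis] representation_scale[OF independent_basis])
  then show ?case
    using step vanishing_mult[OF vanishing_0 x(2), of "c * rep z b"] by (auto intro: vanishing_add)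
qed

text \<open>The unit ideal satisfies both combinatorial hypotheses, but then \<open>e\<close> would
  be a boundary, and by minimality its coordinate 1 would lie in the irrelevant ideal.\<close>

lemma one_notin_ideal: "1 \<notin> I"
proof
  assume "1 \<in> I"
  then have "e \<in> (\<lambda>s. scale s e) ` I" by (intro image_eqI[of _ _ 1]) auto
  then obtain x where "e = d x" using exact_0 by blast
  then have "rep e e \<in> vanishing 1" using rep_vanishing minimal by simp
  moreover have "e \<in> basis" using basis_0 by blast
  ultimately show False
    by (simp add: representation_basis[OF independent_basis] vanishing_def)
qed

end

section \<open>The comparison map from the given resolution to the model\<close>

locale comparison =
  minimal_free_resolution scale I B deg d e + regular_decomposition I st g sep
  for scale :: "('n::{finite,linorder}, 'k::field) mpoly \<Rightarrow> 'm::ab_group_add \<Rightarrow> 'm"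
    and I B deg d e st g sep
begin

sublocale d: module_hom scale scale d
  by (rule d_linear)

definition blin :: "('m \<Rightarrow> 'n label \<Rightarrow>\<^sub>0 ('n, 'k) mpoly) \<Rightarrow> 'm \<Rightarrow> 'n label \<Rightarrow>\<^sub>0 ('n, 'k) mpoly" where
  "blin f x = (\<Sum>b | rep x b \<noteq> 0. fscale (rep x b) (f b))"

lemma blin_superset:
  assumes "finite A" "{b. rep x b \<noteq> 0} \<subseteq> A"
  shows "blin f x = (\<Sum>b\<in>A. fscale (rep x b) (f b))"
  unfolding blin_def using assms by (intro sum.mono_neutral_left) auto

lemma blin_hom: "module_hom scale fscale (blin f)"
proof unfold_locales
  fix x y
  let ?A = "{b. rep x b \<noteq> 0} \<union> {b. rep y b \<noteq> 0}"
  have A: "finite ?A" by (simp add: finite_representation)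
  moreover have "{b. rep (x + y) b \<noteq> 0} \<subseteq> ?A"
    by (auto simp: representation_add[OF independent_basis])
  ultimately show "blin f (x + y) = blin f x + blin f y"
    by (simp add: blin_superset[of ?A] representation_add[OF independent_basis]
        free.scale_left_distrib sum.distrib)
next
  fix c x
  have "{b. rep (scale c x) b \<noteq> 0} \<subseteq> {b. rep x b \<noteq> 0}"
    by (auto simp: representation_scale[OF independent_basis])
  then show "blin f (scale c x) = fscale c (blin f x)"
    by (simp add: blin_superset[of "{b. rep x b \<noteq> 0}"] finite_representation
        representation_scale[OF independent_basis] free.scale_sum_right)
qed

lemma blin_basis: "b \<in> basis \<Longrightarrow> blin f b = f b"
  by (simp add: blin_def representation_basis[OF independent_basis])

lemma blin_cong:
  assumes "x \<in> F p" "\<And>b. b \<in> B p \<Longrightarrow> f b = f' b"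
  shows "blin f x = blin f' x"
proof -
  interpret f: module_hom scale fscale "blin f" by (rule blin_hom)
  interpret f': module_hom scale fscale "blin f'" by (rule blin_hom)
  show ?thesis
    using assms(1)
  proof (induction rule: span_induct_alt)
    case base
    then show ?case by (simp add: f.zero f'.zero)
  next
    case (step c x y)
    have "x \<in> basis" using step(1) by blast
    then have "blin f x = blin f' x" using assms(2)[OF step(1)] by (simp only: blin_basis)
    then show ?case using step by (simp add: f.add f'.add f.scale f'.scale)
  qed
qed

text \<open>The usual lift of the identity of \<open>S/I\<close>, made explicit: \<open>h\<close>
  selects a preimage of the cycle \<open>beta (d b)\<close> in the model.\<close>

primrec beta_basis :: "nat \<Rightarrow> 'm \<Rightarrow> 'n label \<Rightarrow>\<^sub>0 ('n, 'k) mpoly" where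
  "beta_basis 0 b = unit_vec Bot"
| "beta_basis (Suc p) b = h (blin (beta_basis p) (d b))"

definition beta where
  "beta = blin (\<lambda>b. beta_basis (THE p. b \<in> B p) b)"

sublocale beta: module_hom scale fscale beta
  unfolding beta_def by (rule blin_hom)

lemma the_index: "b \<in> B p \<Longrightarrow> (THE p. b \<in> B p) = p"
  using disjoint_bases by (intro the_equality) (auto simp: disjoint_family_on_def)

lemma beta_eq_basis: "b \<in> B p \<Longrightarrow> beta b = beta_basis p b"
  unfolding beta_def by (subst blin_basis) (auto simp: the_index)

lemma beta_e: "beta e = unit_vec Bot"
  using beta_eq_basis[of e 0] basis_0 by simp

lemma beta_Suc: "b \<in> B (Suc p) \<Longrightarrow> beta b = h (beta (d b))"
proof -
  assume b: "b \<in> B (Suc p)"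
  have "d b \<in> F p" using d_Suc[OF span_base[OF b]] .
  then have "blin (beta_basis p) (d b) = beta (d b)"
    unfolding beta_def by (rule blin_cong) (simp add: the_index)
  then show ?thesis by (simp add: beta_eq_basis[OF b])
qed

lemma beta_homogeneous:
  "b \<in> B p \<Longrightarrow> beta b \<in> supported (\<lambda>m l. valid l \<and> level l = p \<and> int (mdeg m + ldeg l) = deg b)"
proof (induction p arbitrary: b)
  case 0
  then show ?case by (simp add: basis_0 beta_e deg_e supported_unit_vec)
next
  case (Suc p)
  obtain f where f: "d b = (\<Sum>c\<in>B p. scale (f c) c)" "\<And>c. c \<in> B p \<Longrightarrow> homogeneous (deg b - deg c) (f c)"
    using d_graded[OF Suc.prems] by (auto simp: degree_part_def)
  have "beta (d b) = (\<Sum>c\<in>B p. fscale (f c) (beta c))"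
    by (simp add: f(1) beta.sum beta.scale)
  also have "\<dots> \<in> supported (\<lambda>m l. valid l \<and> level l = p \<and> int (mdeg m + ldeg l) = deg b)"
    by (intro supported_sum supported_fscale[OF Suc.IH])
      (use f(2) in \<open>auto simp: homogeneous_def mdeg_def[symmetric]\<close>)
  finally show ?case
    unfolding beta_Suc[OF Suc.prems]
  proof (rule additive_supported[OF additive_h])
    fix m :: "'n \<Rightarrow>\<^sub>0 nat" and l and a :: 'k assume l: "valid l \<and> level l = p \<and> int (mdeg m + ldeg l) = deg b"
    then have "hc m l \<in> supported (\<lambda>m l. valid l \<and> level l = Suc p \<and> int (mdeg m + ldeg l) = deg b)"
      by (intro supported_mono[OF hc_Dcell]) (auto simp: Dcell_def)
    then show "h (single l (single m a)) \<in>
        supported (\<lambda>m l. valid l \<and> level l = Suc p \<and> int (mdeg m + ldeg l) = deg b)"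
      by (simp add: h_single supported_const)
  qed
qed

lemma beta_graded: "x \<in> F p \<Longrightarrow> beta x \<in> graded p"
proof (induction rule: span_induct_alt)
  case (step c x y)
  then show ?case
    unfolding graded_def beta.add beta.scale
    by (intro supported_add supported_fscale[OF beta_homogeneous]) auto
qed (simp add: beta.zero graded_def)

lemma d_d: "x \<in> F p \<Longrightarrow> d (d x) = 0"
proof (cases p)
  case 0
  then show "x \<in> F p \<Longrightarrow> d (d x) = 0" by (simp add: d_0 d.zero)
next
  case (Suc q)
  show "x \<in> F p \<Longrightarrow> d (d x) = 0"
  proof (cases q)
    case 0
    then show "x \<in> F p \<Longrightarrow> d (d x) = 0" using Suc d_Suc d_0 by blast
  next
    case (Suc r)
    then show "x \<in> F p \<Longrightarrow> d (d x) = 0" using \<open>p = Suc q\<close> exact_Suc[of r] by auto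
  qed
qed

lemma single_in_M: "s \<in> I \<longleftrightarrow> (\<forall>m\<in>keys s. m \<in> M)"
  by (subst ideal_eq) (unfold M_def, blast)

lemma Bot_homotopy_supported:
  "s \<in> I \<Longrightarrow> fscale s (unit_vec Bot) \<in> supported (\<lambda>m l. valid l \<and> (l = Bot \<longrightarrow> m \<in> M))"
  by (auto simp: supported_def fscale_single lookup_single when_def single_in_M in_keys_iff split: if_splits)

lemma d_F_1: "d ` F (Suc 0) = (\<lambda>s. scale s e) ` I"
  using exact_0 by (simp add: One_nat_def)

lemma bdry_beta_basis: "b \<in> B p \<Longrightarrow> bdry (beta b) = beta (d b)"
proof (induction p arbitrary: b)
  case 0
  then have "b = e" "e \<in> F 0" by (auto simp: basis_0 span_base)
  then show ?case by (simp add: beta_e d_0 beta.zero)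
next
  case (Suc p)
  have Fb: "b \<in> F (Suc p)" "d b \<in> F p" using span_base[OF Suc.prems] d_Suc by auto
  have ext: "bdry (beta x) = beta (d x)" if "x \<in> F p" for x
    using that
  proof (induction rule: span_induct_alt)
    case base
    show ?case by (simp add: beta.zero d.zero additive.zero[OF additive_bdry])
  next
    case (step c x y)
    then show ?case by (simp add: beta.add beta.scale d.add d.scale bdry_add bdry_fscale Suc.IH)
  qed
  have "bdry (beta (d b)) = 0" using ext[OF Fb(2)] d_d[OF Fb(1)] by (simp add: beta.zero)
  moreover have "beta (d b) \<in> supported (\<lambda>m l. valid l \<and> (l = Bot \<longrightarrow> m \<in> M))"
  proof (cases p)
    case 0
    \<comment> \<open>Exactness at \<open>F_0\<close> puts the coefficient of \<open>Bot\<close>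
      into \<open>I\<close>, so its monomials lie in \<open>M\<close> and the homotopy identity
      applies.\<close>
    have "d b \<in> (\<lambda>s. scale s e) ` I" using Fb(1) by (auto simp: 0 simp flip: d_F_1)
    then show ?thesis using Bot_homotopy_supported by (auto simp: beta.scale beta_e)
  next
    case (Suc q)
    show ?thesis
      by (rule supported_mono[OF beta_graded[OF Fb(2), unfolded graded_def]]) (auto simp: Suc)
  qed
  ultimately show ?case
    using homotopy[of "beta (d b)"] by (simp add: beta_Suc[OF Suc.prems] additive.zero[OF additive_h])
qed

lemma bdry_beta: "bdry (beta x) = beta (d x)"
proof -
  have "x \<in> span basis" by simp
  then show ?thesis
  proof (induction rule: span_induct_alt)
    case base
    show ?case by (simp add: beta.zero d.zero additive.zero[OF additive_bdry])
  next
    case (step c x y)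
    then show ?case by (auto simp: beta.add beta.scale d.add d.scale bdry_add bdry_fscale bdry_beta_basis)
  qed
qed

section \<open>Bijectivity of the comparison map in each degree\<close>

definition inj_at where "inj_at p \<longleftrightarrow> (\<forall>x\<in>F p. beta x = 0 \<longrightarrow> x = 0)"
definition surj_at where "surj_at p \<longleftrightarrow> graded p \<subseteq> beta ` F p"

lemma F_0: "F 0 = range (\<lambda>s. scale s e)"
  by (simp add: basis_0 span_singleton)

lemma inj_at_0: "inj_at 0"
  unfolding inj_at_def
proof (intro ballI impI)
  fix x assume "x \<in> F 0" "beta x = 0"
  then obtain s where s: "x = scale s e" "fscale s (unit_vec (Bot :: 'n label)) = 0"
    by (auto simp: F_0 beta.scale beta_e)
  have "s = 0" using arg_cong[OF s(2), of "\<lambda>v. lookup v Bot"] by simp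
  then show "x = 0" by (simp add: s)
qed

lemma graded_0: "v \<in> graded 0 \<Longrightarrow> v = fscale (lookup v Bot) (unit_vec Bot)"
proof (rule poly_mapping_eqI, rule poly_mapping_eqI)
  fix l m assume "v \<in> graded 0"
  then have "lookup (lookup v l) m = 0" if "l \<noteq> Bot"
    using that by (cases l) (auto simp: graded_def dest: supportedD)
  then show "lookup (lookup v l) m =
      lookup (lookup (fscale (lookup v Bot) (unit_vec Bot)) l) m"
    by (auto simp: fscale_single lookup_single when_def)
qed

lemma surj_at_0: "surj_at 0"
  unfolding surj_at_def
proof
  fix v assume "v \<in> graded 0"
  from graded_0[OF this] have "v = beta (scale (lookup v Bot) e)"
    by (simp add: beta.scale beta_e)
  then show "v \<in> beta ` F 0" unfolding F_0 by blast
qed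

text \<open>A preimage of \<open>bdry w\<close> under \<open>beta\<close> is a cycle by injectivity
  one degree lower, hence a boundary by exactness. For \<open>p = 0\<close> its coefficient is shown
  to lie in \<open>I\<close> instead.\<close>

lemma lift_boundary:
  assumes "surj_at p" "\<And>q. q < p \<Longrightarrow> inj_at q" "w \<in> graded (Suc p)"
  shows "\<exists>y\<in>F (Suc p). bdry (beta y) = bdry w"
proof -
  have "bdry w \<in> graded p"
    unfolding graded_def by (rule supported_mono[OF bdry_graded[OF assms(3)]]) auto
  then obtain z where z: "z \<in> F p" "beta z = bdry w" using assms(1) by (auto simp: surj_at_def)
  have "z \<in> d ` F (Suc p)"
  proof (cases p)
    case 0
    then obtain s where s: "z = scale s e" using z F_0 by auto
    have "bdry w \<in> supported (\<lambda>m l. m \<in> M)"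
      using assms(3) unfolding bdry_def graded_def
    proof (rule slin_supported)
      fix m l assume "valid l \<and> level l = Suc p"
      then obtain u where "l = Lab [] u" "u \<in> G" by (cases l) (auto simp: 0)
      then show "fscale (monom m) (D l) \<in> supported (\<lambda>m l. m \<in> M)"
        by (auto simp: monom_mult in_M intro!: supported_monom_unit_vec)
    qed
    moreover have "lookup (bdry w) Bot = s"
      using z(2) by (simp add: s beta.scale beta_e flip: z(2))
    ultimately have "s \<in> I"
      unfolding single_in_M by (auto simp: in_keys_iff dest: supportedD)
    then show ?thesis by (auto simp: s 0 d_F_1)
  next
    case (Suc q)
    have "d z \<in> F q" using d_Suc z(1) by (simp add: Suc)
    moreover have "beta (d z) = 0"
      using bdry_bdry[OF graded_valid[OF assms(3)]] by (simp add: z(2) flip: bdry_beta)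
    ultimately have "d z = 0" using assms(2)[of q] by (auto simp: Suc inj_at_def)
    then show ?thesis using exact_Suc[of q] z(1) by (auto simp: Suc)
  qed
  then show ?thesis using z by (auto simp: bdry_beta)
qed

text \<open>Graded Nakayama: a basis element of the model is in the image up to a boundary, whose component of
  the same internal degree only involves basis elements of smaller degree.\<close>

lemma surj_at_Suc:
  assumes "surj_at p" "\<And>q. q < p \<Longrightarrow> inj_at q"
  shows "surj_at (Suc p)"
proof -
  let ?N = "beta ` F (Suc p)"
  have add: "v + w \<in> ?N" if vw: "v \<in> ?N" "w \<in> ?N" for v w
  proof -
    obtain x y where "x \<in> F (Suc p)" "y \<in> F (Suc p)" "v = beta x" "w = beta y" using vw by blast
    then show ?thesis by (intro image_eqI[of _ _ "x + y"]) (auto simp: beta.add intro: span_add)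
  qed
  have scl: "fscale c v \<in> ?N" if v: "v \<in> ?N" for c v
  proof -
    obtain x where "x \<in> F (Suc p)" "v = beta x" using v by blast
    then show ?thesis by (intro image_eqI[of _ _ "scale c x"]) (auto simp: beta.scale intro: span_scale)
  qed
  have zero: "0 \<in> ?N" by (intro image_eqI[of _ _ 0]) (auto simp: beta.zero span_zero)
  have sum: "sum f A \<in> ?N" if "\<And>a. a \<in> A \<Longrightarrow> f a \<in> ?N" for f and A :: "('n \<Rightarrow>\<^sub>0 nat) set"
    using that by (induction A rule: infinite_finite_induct) (auto intro: add zero simp del: image_iff)
  have cells: "v \<in> ?N" if "v \<in> supported Q" "\<And>m l. Q m l \<Longrightarrow> unit_vec l \<in> ?N" for v Q
    using that(1)
  proof (induction rule: supported_induct)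
    case (cell m l a)
    have "single l (single m a) = fscale (single m a) (unit_vec l)"
      by (simp add: fscale_single)
    then show ?case using scl[OF that(2)[OF cell]] by simp
  qed (auto intro: add zero)
  \<comment> \<open>The image is a graded submodule: \<open>beta\<close> sends the homogeneous basis
    to homogeneous elements, so a monomial multiple of such an image has a single component.\<close>
  have comp: "component j (beta y) \<in> ?N" if "y \<in> F (Suc p)" for j y
    using that
  proof (induction rule: span_induct_alt)
    case base
    show ?case using zero by (simp add: beta.zero additive.zero[OF additive_component])
  next
    case (step c b y)
    let ?mon = "\<lambda>t. fscale (single t (lookup c t)) (beta b)"
    have "component j (?mon t) \<in> ?N" for t
    proof -
      have "?mon t \<in> supported (\<lambda>m l. int (mdeg m + ldeg l) = int (mdeg t) + deg b)"
        by (rule supported_fscale[OF beta_homogeneous[OF step(1)]]) (auto split: if_splits)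
      from component_homogeneous[OF this, of j] show ?thesis
        using zero scl[of "beta b"] span_base[OF step(1)] by auto
    qed
    moreover have "fscale c (beta b) = (\<Sum>t\<in>keys c. ?mon t)"
      by (simp add: sum_singles flip: free.scale_sum_left)
    ultimately have "component j (fscale c (beta b)) \<in> ?N"
      by (simp only: additive.sum[OF additive_component]) (rule sum)
    with step show ?case
      by (simp only: beta.add beta.scale additive.add[OF additive_component]) (rule add)
  qed
  have unit: "unit_vec l \<in> ?N" if "valid l" "level l = Suc p" for l
    using that
  proof (induction "ldeg l" arbitrary: l rule: less_induct)
    case less
    let ?l = "unit_vec l :: 'n label \<Rightarrow>\<^sub>0 ('n, 'k) mpoly" and ?j = "int (ldeg l)"
    have gl: "?l \<in> graded (Suc p)" using graded_unit_vec[OF less.prems(1)] less.prems(2) by simp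
    obtain y where y: "y \<in> F (Suc p)" "bdry (beta y) = bdry ?l"
      using lift_boundary[OF assms gl] by blast
    let ?w = "?l - beta y"
    have w: "?w \<in> graded (Suc p)"
      using gl beta_graded[OF y(1)] unfolding graded_def by (rule supported_diff)
    have "bdry ?w = 0" using y by (simp add: additive.diff[OF additive_bdry])
    then have "bdry (h ?w) = ?w"
      using homotopy_graded[OF w] by (simp add: additive.zero[OF additive_h])
    then have "?w \<in> supported (\<lambda>m l. m \<noteq> 0 \<and> valid l \<and> level l = Suc p)"
      using bdry_graded[OF h_graded[OF w]] by simp
    from component_supported[OF this, of ?j] have "component ?j ?w \<in> ?N"
    proof (rule cells)
      fix m l' assume "(m \<noteq> 0 \<and> valid l' \<and> level l' = Suc p) \<and> int (mdeg m + ldeg l') = ?j"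
      then show "unit_vec l' \<in> ?N" using less.hyps[of l'] mdeg_pos[of m] by auto
    qed
    from add[OF this comp[OF y(1), of ?j]] have "component ?j ?l \<in> ?N"
      by (simp only: additive.diff[OF additive_component] diff_add_cancel)
    moreover have "component ?j ?l = ?l"
      using component_homogeneous[of ?l ?j ?j] by (simp add: supported_unit_vec)
    ultimately show ?case by simp
  qed
  show ?thesis
    unfolding surj_at_def using cells[OF _ unit] by (auto simp: graded_def)
qed

text \<open>Injectivity in degree \<open>p\<close> makes an element of the kernel a cycle, exactness
  makes it a boundary, and boundaries have coordinates in the irrelevant ideal.\<close>

lemma kernel_vanishing:
  assumes "inj_at p" "x \<in> F (Suc p)" "beta x = 0"
  shows "rep x b \<in> vanishing 1"
proof -
  have "d x \<in> F p" "beta (d x) = 0"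
    using assms d_Suc by (auto simp: additive.zero[OF additive_bdry] simp flip: bdry_beta)
  then have "d x = 0" using assms(1) by (auto simp: inj_at_def)
  then obtain y where "x = d y" using exact_Suc[of p] assms(2) by blast
  then show ?thesis using rep_vanishing minimal by simp
qed

text \<open>
  A section \<open>s\<close> of \<open>beta\<close> exists, as the model is free. On the kernel, the identity equals
  \<open>1 - s beta\<close>, whose matrix has entries in the irrelevant ideal by minimality; so the coordinates
  of an element of the kernel vanish to every order.
\<close>

lemma inj_at_Suc:
  assumes "inj_at p" "surj_at (Suc p)"
  shows "inj_at (Suc p)"
  unfolding inj_at_def
proof (intro ballI impI)
  fix x assume x: "x \<in> F (Suc p)" "beta x = 0"
  have "\<exists>s. s \<in> F (Suc p) \<and> beta s = unit_vec l" if "valid l" "level l = Suc p" for l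
  proof -
    have "(unit_vec l :: 'n label \<Rightarrow>\<^sub>0 ('n, 'k) mpoly) \<in> beta ` F (Suc p)"
      using graded_unit_vec[OF that(1)] assms(2) by (auto simp: surj_at_def that(2))
    then show ?thesis by (metis imageE)
  qed
  then obtain s where s: "\<And>l. valid l \<Longrightarrow> level l = Suc p \<Longrightarrow> s l \<in> F (Suc p) \<and> beta (s l) = unit_vec l"
    by metis
  interpret gam: module_hom fscale scale "lin_ext s" by (rule lin_ext_hom)
  have gam: "lin_ext s v \<in> F (Suc p) \<and> beta (lin_ext s v) = v" if "v \<in> graded (Suc p)" for v
    using that unfolding graded_def
  proof (induction rule: supported_induct)
    case (cell m l a)
    then show ?case using s by (auto simp: beta.scale fscale_single intro: span_scale)
  qed (auto simp: gam.zero gam.add beta.zero beta.add span_zero span_add)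
  have sub: "B (Suc p) \<subseteq> basis" by auto
  have rep: "y = (\<Sum>b\<in>B (Suc p). scale (rep y b) b)" if "y \<in> F (Suc p)" for y
  proof -
    have "rep y = representation (B (Suc p)) y"
      by (rule representation_extend[OF independent_basis that sub])
    then show ?thesis
      using sum_representation_eq[OF independent_mono[OF independent_basis sub] that
          finite_basis order_refl] by simp
  qed
  define r where "r b = b - lin_ext s (beta b)" for b
  have r: "rep (r b) c \<in> vanishing 1" if "b \<in> B (Suc p)" for b c
  proof (rule kernel_vanishing[OF assms(1)])
    have b: "b \<in> F (Suc p)" by (rule span_base[OF that])
    from gam[OF beta_graded[OF b]] b show "r b \<in> F (Suc p)" "beta (r b) = 0"
      by (auto simp: r_def beta.diff intro: span_diff)
  qed
  have "lin_ext s (beta x) = (\<Sum>b\<in>B (Suc p). scale (rep x b) (lin_ext s (beta b)))"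
    by (subst rep[OF x(1)]) (simp add: beta.sum beta.scale gam.sum gam.scale)
  then have sum_r: "x = (\<Sum>b\<in>B (Suc p). scale (rep x b) (r b))"
    using rep[OF x(1)] x(2) by (simp add: r_def scale_right_diff_distrib sum_subtractf gam.zero)
  then have rep_x: "rep x c = (\<Sum>b\<in>B (Suc p). rep x b * rep (r b) c)" for c
  proof -
    have "rep x c = rep (\<Sum>b\<in>B (Suc p). scale (rep x b) (r b)) c"
      using arg_cong[OF sum_r, of "\<lambda>x. rep x c"] .
    also have "\<dots> = (\<Sum>b\<in>B (Suc p). rep (scale (rep x b) (r b)) c)"
      by (subst representation_sum[OF independent_basis]) simp_all
    also have "\<dots> = (\<Sum>b\<in>B (Suc p). rep x b * rep (r b) c)"
      by (simp only: representation_scale[OF independent_basis in_span])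
    finally show ?thesis .
  qed
  have "rep x c \<in> vanishing n" for n c
  proof (induction n arbitrary: c)
    case (Suc n)
    have "rep x b * rep (r b) c \<in> vanishing (Suc n)" if "b \<in> B (Suc p)" for b
      using vanishing_mult[OF Suc.IH[of b] r[OF that, of c]] by (simp add: One_nat_def)
    then show ?case by (subst rep_x) (rule vanishing_sum)
  qed simp
  then have "rep x c = 0" for c by (rule vanishing_all)
  then show "x = 0" using rep[OF x(1)] by simp
qed

lemma inj_surj_at: "inj_at p \<and> surj_at p"
proof (induction p rule: less_induct)
  case (less p)
  show ?case
  proof (cases p)
    case 0
    then show ?thesis by (simp add: inj_at_0 surj_at_0)
  next
    case (Suc q)
    with less have "inj_at q" "surj_at q" "\<And>r. r < q \<Longrightarrow> inj_at r" by auto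
    then show ?thesis using surj_at_Suc inj_at_Suc Suc by blast
  qed
qed

section \<open>Transport of the product along the comparison map\<close>

lemma decomposition: "\<exists>n xs. (\<forall>p. xs p \<in> F p) \<and> x = (\<Sum>p<n. xs p)"
proof -
  have "x \<in> span basis" by simp
  then show ?thesis
  proof (induction rule: span_induct_alt)
    case base
    show ?case by (rule exI[of _ 0], rule exI[of _ "\<lambda>_. 0"]) (simp add: span_zero)
  next
    case (step c b y)
    then obtain n xs q where *: "\<forall>p. xs p \<in> F p" "y = (\<Sum>p<n. xs p)" "b \<in> B q" by auto
    let ?ys = "\<lambda>p. (if p < n then xs p else 0) + (if p = q then scale c b else 0)"
    have "scale c b + y = (\<Sum>p<max n (Suc q). ?ys p)"
    proof -
      have "(\<Sum>p<max n (Suc q). if p < n then xs p else 0) = (\<Sum>p<n. xs p)"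
        by (intro sum.mono_neutral_cong_right) auto
      then show ?thesis by (simp add: sum.distrib * add.commute less_max_iff_disj)
    qed
    moreover have "?ys p \<in> F p" for p
      using * by (auto intro!: span_add span_scale[OF span_base] span_zero)
    ultimately show ?case
      by (intro exI[of _ "max n (Suc q)"] exI[of _ ?ys] conjI allI)
  qed
qed

lemma beta_inj: "beta x = beta y \<Longrightarrow> x = y"
proof -
  assume eq: "beta x = beta y"
  obtain n xs where xs: "\<And>p. xs p \<in> F p" "x - y = (\<Sum>p<n. xs p)" using decomposition[of "x - y"] by auto
  have gr: "beta (xs p) \<in> graded p" for p by (rule beta_graded[OF xs(1)])
  have "xs q = 0" if q: "q < n" for q
  proof -
    have off: "lookup (beta (xs p)) l = 0" if "p \<noteq> level l" for p l
      using gr[of p] that by (intro poly_mapping_eqI) (auto simp: graded_def dest: supportedD)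
    have "lookup (beta (xs q)) l = 0" for l
    proof (cases "q = level l")
      case True
      have "0 = lookup (beta (x - y)) l" using eq by (simp add: beta.diff)
      also have "\<dots> = (\<Sum>p<n. lookup (beta (xs p)) l)"
        by (simp add: xs(2) beta.sum lookup_sum)
      also have "\<dots> = (\<Sum>p<n. if p = q then lookup (beta (xs q)) l else 0)"
        using off True by (intro sum.cong) auto
      also have "\<dots> = lookup (beta (xs q)) l" using q by simp
      finally show ?thesis by simp
    qed (rule off)
    then have "beta (xs q) = 0" by (intro poly_mapping_eqI) simp
    then show ?thesis using inj_surj_at[of q] xs(1) by (auto simp: inj_at_def)
  qed
  then have "x - y = 0" unfolding xs(2) by (intro sum.neutral) simp
  then show "x = y" by simp
qed

lemma beta_valid: "beta x \<in> supported (\<lambda>_. valid)"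
proof -
  obtain n xs where xs: "\<And>p. xs p \<in> F p" "x = (\<Sum>p<n. xs p)" using decomposition[of x] by auto
  have "beta (xs p) \<in> supported (\<lambda>_. valid)" for p
    by (rule graded_valid[OF beta_graded[OF xs(1)]])
  then show ?thesis
    by (simp add: xs(2) beta.sum supported_sum)
qed

lemma beta_surj: "v \<in> supported (\<lambda>_. valid) \<Longrightarrow> \<exists>x. beta x = v"
proof (induction rule: supported_induct)
  case zero
  then show ?case using beta.zero by blast
next
  case (add x y)
  then show ?case using beta.add by metis
next
  case (cell m l a)
  have "(unit_vec l :: 'n label \<Rightarrow>\<^sub>0 ('n, 'k) mpoly) \<in> beta ` F (level l)"
    using graded_unit_vec[OF cell] inj_surj_at[of "level l"] unfolding surj_at_def by blast
  then obtain x where "beta x = unit_vec l" by (metis imageE)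
  then have "beta (scale (single m a) x) = single l (single m a)"
    by (simp add: beta.scale fscale_single)
  then show ?case by blast
qed

text \<open>Since \<open>mu\<close> preserves the span of the valid symbols, which is the image of
  the injective map \<open>beta\<close>, the chosen preimage exists and is unique; each axiom is
  then checked after applying \<open>beta\<close>.\<close>

definition product :: "'m \<Rightarrow> 'm \<Rightarrow> 'm" where
  "product x y = (SOME z. beta z = mu (beta x) (beta y))"

lemma beta_product: "beta (product x y) = mu (beta x) (beta y)"
  unfolding product_def by (rule someI_ex, rule beta_surj, rule mu_valid; rule beta_valid)

lemma product_dga: "dga_structure scale I B deg d e product"
proof (intro dga_structure.intro dga_structure_axioms.intro)
  show "graded_free_resolution scale I B deg d e" by (rule graded_free_resolution_axioms)
next
  show "module_hom scale scale (\<lambda>x. product x y)" for y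
    by unfold_locales (rule beta_inj, simp add: beta_product beta.add beta.scale mu_add_left mu_fscale_left)+
next
  show "module_hom scale scale (product x)" for x
    by unfold_locales (rule beta_inj, simp add: beta_product beta.add beta.scale mu_add_right mu_fscale_right)+
next
  fix x y p q assume xy: "x \<in> F p" "y \<in> F q"
  have "beta (product x y) \<in> graded (p + q)"
    unfolding beta_product by (intro mu_graded beta_graded xy)
  then obtain z where "z \<in> F (p + q)" "beta (product x y) = beta z"
    using inj_surj_at[of "p + q"] by (auto simp: surj_at_def)
  then show "product x y \<in> F (p + q)" using beta_inj by metis
  show "product x y = scale ((-1) ^ (p * q)) (product y x)"
    by (rule beta_inj, unfold beta.scale beta_product, rule mu_commute[OF beta_graded[OF xy(1)] beta_graded[OF xy(2)]])
next
  fix x y p assume x: "x \<in> F p"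
  show "d (product x y) = product (d x) y + scale ((-1) ^ p) (product x (d y))"
    by (rule beta_inj)
      (simp only: beta.add beta.scale beta_product bdry_beta[symmetric]
        leibniz_valid[OF beta_graded[OF x] beta_valid])
next
  show "product (product x y) z = product x (product y z)" for x y z
    by (rule beta_inj) (simp add: beta_product assoc_mu beta_valid)
next
  show "product e x = x" "product x e = x" for x
    by (rule beta_inj; simp add: beta_product beta_e mu_Bot_left mu_Bot_right)+
qed

end

section \<open>Monomial ideals\<close>

lemma monom_dvd_monom:
  "(monom b :: ('n, 'k::comm_ring_1) mpoly) dvd monom a \<longleftrightarrow> (\<exists>y. a = b + y)"
proof
  assume "(monom b :: ('n, 'k) mpoly) dvd monom a"
  then obtain q where q: "(monom a :: ('n, 'k) mpoly) = monom b * q" by (auto elim: dvdE)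
  have "a \<in> keys (monom a :: ('n, 'k) mpoly)" by simp
  then show "\<exists>y. a = b + y" unfolding q using keys_mult[of "monom b" q] by auto
qed (auto simp: monom_mult[symmetric])

lemma ideal_gen_monom:
  "f \<in> ideal_gen (monom ` A :: ('n, 'k::comm_ring_1) mpoly set) \<longleftrightarrow>
    (\<forall>m\<in>keys f. \<exists>a\<in>A. \<exists>y. m = a + y)"
  unfolding ideal_gen_def
proof
  assume "f \<in> ring_module.span (monom ` A :: ('n, 'k) mpoly set)"
  then show "\<forall>m\<in>keys f. \<exists>a\<in>A. \<exists>y. m = a + y"
  proof (induction rule: ring_module.span_induct_alt)
    case (step c x y)
    then obtain a where a: "a \<in> A" "x = monom a" by auto
    have "keys (c * x + y) \<subseteq> keys (c * x) \<union> keys y"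
      by (rule keys_add)
    moreover have "\<exists>y. m = a + y" if "m \<in> keys (c * x)" for m
      using that keys_mult[of c x] by (auto simp: a add.commute)
    ultimately show ?case using step a(1) by blast
  qed simp
next
  assume *: "\<forall>m\<in>keys f. \<exists>a\<in>A. \<exists>y. m = a + y"
  have "(\<Sum>m\<in>keys f. single m (lookup f m)) \<in>
      ring_module.span (monom ` A)"
  proof (rule ring_module.span_sum)
    fix m assume "m \<in> keys f"
    then obtain a y where a: "a \<in> A" "m = a + y" using * by blast
    have "single y (lookup f m) * monom a \<in> ring_module.span (monom ` A)"
      using a by (intro ring_module.span_scale ring_module.span_base) auto
    then show "single m (lookup f m) \<in> ring_module.span (monom ` A)"
      by (simp add: monom_def mult_single a(2) add.commute)
  qed
  then show "f \<in> ring_module.span (monom ` A)" by (simp add: sum_singles)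
qed

lemma monom_in_ideal_add:
  assumes "monomial_ideal I" "monom a \<in> I"
  shows "monom (a + y) \<in> I"
  using assms unfolding monomial_ideal_def by (auto simp: ideal_gen_monom add.assoc) blast

lemma min_gens_dvd:
  fixes I :: "('n::finite, 'k::comm_ring_1) mpoly set"
  shows "monom m \<in> I \<Longrightarrow> \<exists>u\<in>min_gens I. \<exists>y. m = u + y"
proof (induction "mdeg m" arbitrary: m rule: less_induct)
  case less
  show ?case
  proof (cases "m \<in> min_gens I")
    case True
    then show ?thesis by (intro bexI[of _ m] exI[of _ 0]) auto
  next
    case False
    then obtain b y where b: "monom b \<in> I" "m = b + y" "b \<noteq> m"
      using less.prems unfolding min_gens_def by (auto simp: monom_dvd_monom)
    then have "mdeg b < mdeg m" using mdeg_pos[of y] by auto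
    from less.hyps[OF this b(1)] show ?thesis by (auto simp: b(2) add.assoc) blast
  qed
qed

lemma monomial_ideal_iff:
  fixes I :: "('n::finite, 'k::comm_ring_1) mpoly set"
  assumes "monomial_ideal I"
  shows "f \<in> I \<longleftrightarrow> (\<forall>m\<in>keys f. \<exists>u\<in>min_gens I. \<exists>y. m = u + y)"
proof -
  have "f \<in> I \<longleftrightarrow> (\<forall>m\<in>keys f. monom m \<in> I)"
    using assms unfolding monomial_ideal_def by (auto simp: ideal_gen_monom)
  also have "\<dots> \<longleftrightarrow> (\<forall>m\<in>keys f. \<exists>u\<in>min_gens I. \<exists>y. m = u + y)"
  proof (intro ball_cong refl iffI)
    fix m assume "monom m \<in> I"
    then show "\<exists>u\<in>min_gens I. \<exists>y. m = u + y" by (rule min_gens_dvd)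
  next
    fix m assume "\<exists>u\<in>min_gens I. \<exists>y. m = u + y"
    then show "monom m \<in> I" using monom_in_ideal_add[OF assms] by (auto simp: min_gens_def)
  qed
  finally show ?thesis .
qed

lemma min_gens_antichain:
  "u \<in> min_gens I \<Longrightarrow> u + y \<in> min_gens (I :: ('n, 'k::comm_ring_1) mpoly set) \<Longrightarrow> y = 0"
  unfolding min_gens_def by (auto simp: monom_dvd_monom)

text \<open>The hypotheses speak about decompositions \<open>u + y = w + z\<close> and leave
  \<open>g\<close> out. It is obtained by choice, and uniqueness identifies its value on monomials
  already decomposed.\<close>

lemma regular_decompositionI:
  fixes I :: "('n::{finite,linorder}, 'k::field) mpoly set"
  assumes mi: "monomial_ideal I" and zero: "1 \<notin> I"
    and ex: "\<And>u y. u \<in> min_gens I \<Longrightarrow>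
      \<exists>w\<in>min_gens I. \<exists>z. u + y = w + z \<and> keys z \<inter> st w = {}"
    and uniq: "\<And>u w y z. u \<in> min_gens I \<Longrightarrow> w \<in> min_gens I \<Longrightarrow> u + y = w + z \<Longrightarrow>
      keys y \<inter> st u = {} \<Longrightarrow> keys z \<inter> st w = {} \<Longrightarrow> u = w"
    and step: "\<And>u w i z. u \<in> min_gens I \<Longrightarrow> w \<in> min_gens I \<Longrightarrow> i \<in> st u \<Longrightarrow> u + xp i = w + z \<Longrightarrow>
      keys z \<inter> st w = {} \<Longrightarrow> st w \<subseteq> st u \<and> (sep \<longrightarrow> i \<notin> st w)"
    and exch: "\<And>u v j. sep \<Longrightarrow> u \<in> min_gens I \<Longrightarrow> v \<in> min_gens I \<Longrightarrow> j \<in> st v \<Longrightarrow> j \<notin> st u \<Longrightarrow>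
      \<exists>i\<in>keys u \<inter> st v. i \<le> j"
    and initial: "\<And>u i j. \<not> sep \<Longrightarrow> u \<in> min_gens I \<Longrightarrow> j \<notin> st u \<Longrightarrow> i \<in> keys u \<Longrightarrow> i \<le> j"
  shows "\<exists>g. regular_decomposition I st g sep"
proof -
  define g where "g m = (SOME w. w \<in> min_gens I \<and> (\<exists>z. m = w + z \<and> keys z \<inter> st w = {}))" for m
  have g: "g (u + y) \<in> min_gens I \<and> (\<exists>z. u + y = g (u + y) + z \<and> keys z \<inter> st (g (u + y)) = {})"
    if "u \<in> min_gens I" for u y
    unfolding g_def by (rule someI_ex) (use ex[OF that] in blast)
  have "regular_decomposition I st g sep"
  proof
    show "f \<in> I \<longleftrightarrow> (\<forall>m\<in>keys f. \<exists>u\<in>min_gens I. \<exists>y. m = u + y)" for f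
      by (rule monomial_ideal_iff[OF mi])
    show "0 \<notin> min_gens I" using zero by (auto simp: min_gens_def)
    show "u \<in> min_gens I \<Longrightarrow> u + y \<in> min_gens I \<Longrightarrow> y = 0" for u y by (rule min_gens_antichain)
    show "g (u + y) \<in> min_gens I"
      "\<exists>z. u + y = g (u + y) + z \<and> keys z \<inter> st (g (u + y)) = {}"
      if "u \<in> min_gens I" for u y using g[OF that] by auto
    show "g (u + y) = u" if "u \<in> min_gens I" "keys y \<inter> st u = {}" for u y
    proof -
      note u = that
      obtain z where z: "u + y = g (u + y) + z" "keys z \<inter> st (g (u + y)) = {}"
        using g[OF u(1), of y] by blast
      from uniq[OF u(1) conjunct1[OF g[OF u(1)]] z(1) u(2) z(2)] show ?thesis by (rule sym)
    qed
    have *: "st (g (u + xp i)) \<subseteq> st u \<and> (sep \<longrightarrow> i \<notin> st (g (u + xp i)))"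
      if "u \<in> min_gens I" "i \<in> st u" for u i
    proof -
      note u = that
      obtain z where z: "u + xp i = g (u + xp i) + z" "keys z \<inter> st (g (u + xp i)) = {}"
        using g[OF u(1), of "xp i"] by blast
      from step[OF u(1) conjunct1[OF g[OF u(1)]] u(2) z] show ?thesis .
    qed
    show "st (g (u + xp i)) \<subseteq> st u" if "u \<in> min_gens I" "i \<in> st u" for u i
      using *[OF that] by blast
    show "i \<notin> st (g (u + xp i))" if "sep" "u \<in> min_gens I" "i \<in> st u" for u i
      using *[OF that(2,3)] that(1) by blast
    show "\<exists>i\<in>keys u \<inter> st v. i \<le> j"
      if "sep" "u \<in> min_gens I" "v \<in> min_gens I" "j \<in> st v" "j \<notin> st u" for u v j
      by (rule exch[OF that])
    show "i \<le> j" if "\<not> sep" "u \<in> min_gens I" "j \<notin> st u" "i \<in> keys u" for u i j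
      by (rule initial[OF that])
  qed
  then show ?thesis by (rule exI[of _ g])
qed

section \<open>Stable ideals\<close>

lemma add_diff_poly: "i \<in> keys y \<Longrightarrow> b + y - xp i = b + (y - xp i)"
  by (rule poly_mapping_eqI) (auto simp: lookup_add lookup_minus lookup_single when_def in_keys_iff)

lemma stable_decomposition_exists:
  fixes I :: "('n::{finite,linorder}, 'k::field) mpoly set"
  assumes st: "stable_monomial_ideal I" and zero: "1 \<notin> I"
  shows "monom m \<in> I \<Longrightarrow>
    \<exists>w\<in>min_gens I. \<exists>z. m = w + z \<and> (\<forall>j\<in>keys z. Max (keys w) \<le> j)"
proof (induction "mdeg m" arbitrary: m rule: less_induct)
  case less
  have mi: "monomial_ideal I" using st by (simp add: stable_monomial_ideal_def)
  show ?case
  proof (cases "m \<in> min_gens I")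
    case True
    then show ?thesis by (intro bexI[of _ m] exI[of _ 0]) auto
  next
    case False
    have m0: "m \<noteq> 0" using less.prems zero by auto
    define k where "k = Max (keys m)"
    have k: "k \<in> keys m" "\<And>j. j \<in> keys m \<Longrightarrow> j \<le> k"
      using m0 by (auto simp: k_def intro!: Max_in Max_ge)
    have mk: "m = m - xp k + xp k" by (rule diff_xp_add[OF k(1), symmetric])
    \<comment> \<open>The largest variable can be stripped from a nonminimal
      \<open>m = b + y\<close>. If it occurs in \<open>y\<close>, then \<open>b\<close> still
      divides the quotient. Otherwise it is the largest variable of \<open>b\<close>, and stability
      trades it for a variable of \<open>y\<close>; the monomial so obtained divides the
      quotient.\<close>
    have "monom (m - xp k) \<in> I"
    proof (rule ccontr)
      assume notin: "monom (m - xp k) \<notin> I"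
      obtain b y where b: "monom b \<in> I" "m = b + y" "b \<noteq> m"
        using False less.prems unfolding min_gens_def by (auto simp: monom_dvd_monom)
      have ky: "k \<notin> keys y"
      proof
        assume "k \<in> keys y"
        then have "monom (m - xp k) \<in> I"
          using monom_in_ideal_add[OF mi b(1)] by (simp add: b(2) add_diff_poly)
        with notin show False by simp
      qed
      then have kb: "k \<in> keys b" using k(1) b(2) by simp
      have Max_b: "Max (keys b) = k" using kb k(2) b(2) by (intro Max_eqI) auto
      have "y \<noteq> 0" using b by auto
      then obtain i where i: "i \<in> keys y" by (metis keys_eq_empty ex_in_conv)
      then have "i < k" using ky k(2)[of i] b(2) by (cases "i = k") auto
      moreover have "b \<noteq> 0" using kb by auto
      moreover have "\<forall>i<Max (keys b). monom (b - xp (Max (keys b)) + xp i) \<in> I"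
        using st b(1) \<open>b \<noteq> 0\<close> unfolding stable_monomial_ideal_def Let_def by blast
      ultimately have "monom (b - xp k + xp i) \<in> I" by (simp add: Max_b)
      then have "monom (b - xp k + xp i + (y - xp i)) \<in> I" by (rule monom_in_ideal_add[OF mi])
      moreover have "b - xp k + xp i + (y - xp i) = m - xp k"
      proof -
        have "b - xp k + xp i + (y - xp i) = b - xp k + (y - xp i + xp i)"
          by (simp only: add.assoc add.commute[of "xp i"])
        also have "\<dots> = b - xp k + y" by (simp only: diff_xp_add[OF i])
        also have "\<dots> = m - xp k" using add_diff_poly[OF kb, of y] by (simp add: b(2) add.commute)
        finally show ?thesis .
      qed
      ultimately show False using notin by simp
    qed
    moreover have "mdeg (m - xp k) < mdeg m" using arg_cong[OF mk, of mdeg] by simp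
    ultimately obtain w z where w: "w \<in> min_gens I" "m - xp k = w + z"
        "\<forall>j\<in>keys z. Max (keys w) \<le> j"
      using less.hyps by blast
    have m: "m = w + (z + xp k)" using mk w(2) by (simp add: add.assoc)
    have "w \<noteq> 0" using w(1) zero by (auto simp: min_gens_def)
    then have "Max (keys w) \<le> k" using k(2) m by (subst Max_le_iff) auto
    then have "\<forall>j\<in>keys (z + xp k). Max (keys w) \<le> j" using w(3) by auto
    then show ?thesis using w(1) m by blast
  qed
qed

lemma poly_mapping_le_add:
  fixes u w :: "'n \<Rightarrow>\<^sub>0 nat"
  assumes "\<And>j. lookup u j \<le> lookup w j"
  shows "w = u + (w - u)"
  using assms by (intro poly_mapping_eqI) (simp add: lookup_add lookup_minus)

lemma stable_regular_decomposition:
  fixes I :: "('n::{finite,linorder}, 'k::field) mpoly set"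
  assumes st: "stable_monomial_ideal I" and zero: "1 \<notin> I"
  shows "\<exists>g. regular_decomposition I (\<lambda>u. {j. j < Max (keys u)}) g False"
proof (rule regular_decompositionI)
  show mi: "monomial_ideal I" using st by (simp add: stable_monomial_ideal_def)
  show "1 \<notin> I" by fact
  have ne: "keys u \<noteq> {}" if "u \<in> min_gens I" for u
    using that zero by (auto simp: min_gens_def)
  fix u assume u: "u \<in> min_gens I"
  show "\<exists>w\<in>min_gens I. \<exists>z. u + y = w + z \<and>
      keys z \<inter> {j. j < Max (keys w)} = {}" for y
  proof -
    have "monom (u + y) \<in> I" using u monom_in_ideal_add[OF mi] by (auto simp: min_gens_def)
    from stable_decomposition_exists[OF st zero this]
    obtain w z where w: "w \<in> min_gens I" "u + y = w + z"
        "\<forall>j\<in>keys z. Max (keys w) \<le> j" by blast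
    have "keys z \<inter> {j. j < Max (keys w)} = {}" using w(3) by force
    with w(1,2) show ?thesis by blast
  qed
  show "i \<le> j" if "j \<notin> {j. j < Max (keys u)}" "i \<in> keys u" for i j
    using that(1) Max_ge[OF finite_keys that(2)] by (auto simp: not_less)
  fix w assume w: "w \<in> min_gens I"
  show "{j. j < Max (keys w)} \<subseteq> {j. j < Max (keys u)} \<and>
      (False \<longrightarrow> i \<notin> {j. j < Max (keys w)})"
    if "i \<in> {j. j < Max (keys u)}" "u + xp i = w + z" for i z
  proof -
    have "keys w \<subseteq> insert i (keys u)"
      using arg_cong[OF that(2), of keys] by auto
    moreover have "j \<le> Max (keys u)" if "j \<in> keys u" for j
      using that by simp
    ultimately have "Max (keys w) \<le> Max (keys u)"
      using that(1) ne[OF w] by (subst Max_le_iff) auto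
    then show ?thesis by auto
  qed
  \<comment> \<open>The order by largest variable, ties broken by its exponent, is chosen so that
    \<open>u\<close> divides \<open>w\<close>: below \<open>Max (keys w)\<close> the cofactor
    \<open>z\<close> contributes nothing, and above it \<open>u\<close> has no variables. Minimality
    then gives equality.\<close>
  have aux: "u = w"
    if u: "u \<in> min_gens I" and w: "w \<in> min_gens I" and eq: "u + y = w + z"
      and y: "keys y \<inter> {j. j < Max (keys u)} = {}"
      and z: "keys z \<inter> {j. j < Max (keys w)} = {}"
      and less: "Max (keys u) < Max (keys w) \<or>
        Max (keys u) = Max (keys w) \<and>
        lookup u (Max (keys w)) \<le> lookup w (Max (keys w))"
    for u w y z
  proof -
    have "lookup u j \<le> lookup w j" for j
    proof (cases j "Max (keys w)" rule: linorder_cases)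
      case less
      then have "lookup z j = 0" using z by (auto simp: in_keys_iff)
      then show ?thesis
        using arg_cong[OF eq, of "\<lambda>m. lookup m j"] by (simp add: lookup_add)
    next
      case equal
      show ?thesis
      proof (cases "j \<in> keys u")
        case True
        then have "j \<le> Max (keys u)" by simp
        then show ?thesis using less equal by auto
      next
        case False
        then show ?thesis by (simp add: in_keys_iff)
      qed
    next
      case greater
      have "j \<notin> keys u"
      proof
        assume "j \<in> keys u"
        then have "j \<le> Max (keys u)" by simp
        then show False using less greater by auto
      qed
      then show ?thesis by (simp add: in_keys_iff)
    qed
    from poly_mapping_le_add[OF this] have wu: "w = u + (w - u)" .
    then have "w - u = 0" using min_gens_antichain[OF u, of "w - u"] w by simp
    with wu show "u = w" by simp
  qed
  show "u = w" if "u + y = w + z"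
      "keys y \<inter> {j. j < Max (keys u)} = {}"
      "keys z \<inter> {j. j < Max (keys w)} = {}" for y z
  proof (cases "Max (keys u)" "Max (keys w)" rule: linorder_cases)
    case less
    then show ?thesis by (intro aux[OF u w that] disjI1)
  next
    case greater
    then show ?thesis by (intro aux[OF w u that(1)[symmetric] that(3,2), symmetric] disjI1)
  next
    case equal
    let ?j = "Max (keys w)"
    have "lookup u ?j \<le> lookup w ?j \<or>
        lookup w ?j \<le> lookup u ?j" by (rule nat_le_linear)
    then show ?thesis
    proof
      assume "lookup u ?j \<le> lookup w ?j"
      then show ?thesis using equal by (intro aux[OF u w that]) simp
    next
      assume "lookup w ?j \<le> lookup u ?j"
      then show ?thesis using equal by (intro aux[OF w u that(1)[symmetric] that(3,2), symmetric]) simp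
    qed
  qed
qed auto

section \<open>Matroidal ideals\<close>

locale finite_matroid =
  fixes Ind :: "'n::{finite,linorder} set set"
  assumes matroid: "matroid UNIV Ind"
begin

lemma Ind_subset: "X \<in> Ind \<Longrightarrow> Y \<subseteq> X \<Longrightarrow> Y \<in> Ind"
  using matroid by (auto simp: matroid_def)

lemma Ind_augment: "X \<in> Ind \<Longrightarrow> Y \<in> Ind \<Longrightarrow> card X < card Y \<Longrightarrow> \<exists>y\<in>Y - X. insert y X \<in> Ind"
  using matroid by (auto simp: matroid_def)

lemma Ind_extend:
  "Y \<in> Ind \<Longrightarrow> W \<in> Ind \<Longrightarrow> card Y \<le> card W \<Longrightarrow> \<exists>Z\<in>Ind. Y \<subseteq> Z \<and> Z \<subseteq> Y \<union> W \<and> card Z = card W"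
proof (induction "card W - card Y" arbitrary: Y)
  case 0
  then show ?case by (intro bexI[of _ Y]) auto
next
  case (Suc n)
  have "card Y < card W" using Suc.hyps(2) by linarith
  with Suc.prems obtain y where y: "y \<in> W - Y" "insert y Y \<in> Ind" using Ind_augment[of Y W] by auto
  then have "\<exists>Z\<in>Ind. insert y Y \<subseteq> Z \<and> Z \<subseteq> insert y Y \<union> W \<and> card Z = card W"
    using Suc by (intro Suc.hyps(1)) auto
  then show ?case using y by blast
qed

text \<open>If \<open>Y\<close> lies in the closure of \<open>Y'\<close> and \<open>j\<close> does not, then \<open>j\<close> is not in the closure of \<open>Y\<close>.\<close>

lemma Ind_closure:
  assumes "Y \<in> Ind" "Y' \<in> Ind" "\<And>x. x \<in> Y - Y' \<Longrightarrow> insert x Y' \<notin> Ind" "insert j Y' \<in> Ind" "j \<notin> Y'"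
  shows "insert j Y \<in> Ind"
proof -
  have card: "card Y \<le> card Y'"
  proof (rule ccontr)
    assume "\<not> ?thesis"
    then obtain y where "y \<in> Y - Y'" "insert y Y' \<in> Ind"
      using Ind_augment[OF assms(2,1)] by (auto simp: not_le)
    then show False using assms(3) by blast
  qed
  then obtain Z where Z: "Z \<in> Ind" "Y \<subseteq> Z" "Z \<subseteq> Y \<union> insert j Y'" "card Z = card (insert j Y')"
    using Ind_extend[OF assms(1,4)] assms(5) by auto
  have "j \<in> Z"
  proof (rule ccontr)
    assume "j \<notin> Z"
    obtain z where "z \<in> Z - Y'" "insert z Y' \<in> Ind"
      using Ind_augment[OF assms(2) Z(1)] Z(4) assms(5) by auto
    then show False using assms(3)[of z] Z(3) \<open>j \<notin> Z\<close> by blast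
  qed
  then show ?thesis using Ind_subset[OF Z(1)] Z(2) by auto
qed

section \<open>Greedy bases and passive elements\<close>

abbreviation bases where "bases \<equiv> matroid_bases Ind"

lemma basis_card_le:
  assumes "b \<in> bases" "X \<in> Ind"
  shows "card X \<le> card b"
proof (rule ccontr)
  assume "\<not> ?thesis"
  then obtain y where y: "y \<in> X - b" "insert y b \<in> Ind"
    using assms Ind_augment[of b X] by (auto simp: matroid_bases_def)
  then have "insert y b = b" using assms(1) by (simp add: matroid_bases_def subset_insertI)
  then show False using y(1) by blast
qed

lemma basisI:
  assumes "b \<in> bases" "X \<in> Ind" "card X = card b"
  shows "X \<in> bases"
  unfolding matroid_bases_def
proof (intro CollectI conjI ballI impI assms(2))
  fix Y assume "Y \<in> Ind" "X \<subseteq> Y"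
  then show "Y = X" using basis_card_le[OF assms(1), of Y] assms(3) card_seteq[of Y X] by auto
qed

text \<open>For a basis \<open>b\<close> these are the elements outside \<open>b\<close> that are
  not the largest of their fundamental circuit, that is, the externally passive elements for the
  reversed order.\<close>

definition passive_set :: "'n set \<Rightarrow> 'n set" where
  "passive_set b = {j. j \<notin> b \<and> insert j {i \<in> b. i < j} \<in> Ind}"

lemma basis_Ind: "b \<in> bases \<Longrightarrow> b \<in> Ind" "b \<in> bases \<Longrightarrow> {i \<in> b. i < j} \<in> Ind"
  by (auto simp: matroid_bases_def intro: Ind_subset)

lemma not_passive_lower:
  assumes "x \<notin> passive_set c" "x \<notin> c" "x < j"
  shows "insert x {i \<in> c. i < j} \<notin> Ind"
proof
  assume "insert x {i \<in> c. i < j} \<in> Ind"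
  then have "insert x {i \<in> c. i < x} \<in> Ind" by (rule Ind_subset) (use assms(3) in auto)
  with assms show False by (simp add: passive_set_def)
qed

text \<open>\<open>b\<close> is the greedy basis of \<open>X\<close> iff \<open>b \<subseteq> X\<close> and \<open>X \<inter> passive_set b = {}\<close>.\<close>

lemma greedy_exists:
  "b \<in> bases \<Longrightarrow> b \<subseteq> X \<Longrightarrow> \<exists>c\<in>bases. c \<subseteq> X \<and> X \<inter> passive_set c = {}"
proof (induction "\<Sum>k\<in>b. card {i. i < k}" arbitrary: b rule: less_induct)
  case less
  show ?case
  proof (cases "X \<inter> passive_set b = {}")
    case True
    with less show ?thesis by blast
  next
    case False
    then obtain j where j: "j \<in> X" "j \<notin> b" "insert j {i \<in> b. i < j} \<in> Ind"
      by (auto simp: passive_set_def)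
    obtain Z where Z: "Z \<in> Ind" "insert j {i \<in> b. i < j} \<subseteq> Z" "Z \<subseteq> insert j b" "card Z = card b"
      using Ind_extend[OF j(3) basis_Ind(1)[OF less.prems(1)] basis_card_le[OF less.prems(1) j(3)]] by auto
    have "\<not> b \<subseteq> Z"
    proof
      assume "b \<subseteq> Z"
      then have "insert j b \<subseteq> Z" using Z(2) by auto
      then have "card (insert j b) \<le> card Z" by (intro card_mono) auto
      then show False using j(2) Z(4) by simp
    qed
    then obtain k where k: "k \<in> b" "k \<notin> Z" by auto
    \<comment> \<open>\<open>Z\<close> contains \<open>j\<close> and all elements of
      \<open>b\<close> below \<open>j\<close>, so the element it omits is larger than
      \<open>j\<close>. The exchange therefore lowers the sum of positions that serves as induction
      measure.\<close>
    have jk: "j < k" using k Z(2) j(2) by (cases k j rule: linorder_cases) auto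
    have Zeq: "Z = insert j (b - {k})"
    proof (rule card_subset_eq)
      show "Z \<subseteq> insert j (b - {k})" using Z(3) k(2) by auto
      show "card Z = card (insert j (b - {k}))"
        using j(2) card.remove[OF finite k(1)] Z(4) by simp
    qed simp
    have "card {i. i < j} < card {i. i < k}" using jk by (intro psubset_card_mono) auto
    then have "(\<Sum>k\<in>Z. card {i. i < k}) < (\<Sum>k\<in>b. card {i. i < k})"
      using j(2) k(1) unfolding Zeq by (simp add: sum.remove[of b k])
    moreover have "Z \<in> bases" by (rule basisI[OF less.prems(1) Z(1,4)])
    moreover have "Z \<subseteq> X" using Z(3) j(1) less.prems(2) by auto
    ultimately show ?thesis by (rule less.hyps)
  qed
qed

text \<open>Below the least element of the symmetric difference the two bases agree, so that
  element, which lies in \<open>X\<close>, is passive for the basis not containing it.\<close>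

lemma greedy_unique:
  assumes "b \<in> bases" "c \<in> bases" "b \<subseteq> X" "c \<subseteq> X" "X \<inter> passive_set b = {}" "X \<inter> passive_set c = {}"
  shows "b = c"
proof (rule ccontr)
  assume "b \<noteq> c"
  define S where "S = (b - c) \<union> (c - b)"
  define j where "j = Min S"
  have S: "S \<noteq> {}" using \<open>b \<noteq> c\<close> by (auto simp: S_def)
  have j: "j \<in> S" unfolding j_def using S by (intro Min_in) auto
  have "i \<notin> S" if "i < j" for i
    using that Min_le[OF finite, of i S] by (auto simp: j_def not_less[symmetric])
  then have eq: "{i \<in> b. i < j} = {i \<in> c. i < j}" by (auto simp: S_def)
  have "insert j {i \<in> b. i < j} \<subseteq> b \<or> insert j {i \<in> b. i < j} \<subseteq> c" using j eq by (auto simp: S_def)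
  then have "insert j {i \<in> b. i < j} \<in> Ind"
    using Ind_subset basis_Ind(1) assms(1,2) by blast
  then have "j \<in> passive_set b \<or> j \<in> passive_set c" using j eq by (auto simp: S_def passive_set_def)
  then show False using assms(3-6) j by (auto simp: S_def)
qed

text \<open>By greediness the elements of \<open>b\<close> below \<open>j\<close> lie in the closure
  of those of \<open>c\<close> below \<open>j\<close>, and \<open>Ind_closure\<close> applies. With
  \<open>X\<close> the support of \<open>x_i u\<close> this gives the monotonicity of
  \<open>st\<close>.\<close>

lemma greedy_passive_subset:
  assumes "b \<in> bases" "c \<in> bases" "b \<subseteq> X" "c \<subseteq> X" "X \<inter> passive_set c = {}"
  shows "passive_set c \<subseteq> passive_set b"
proof
  fix j assume j: "j \<in> passive_set c"
  then have "j \<notin> X" using assms(5) by auto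
  have "insert j {i \<in> b. i < j} \<in> Ind"
  proof (rule Ind_closure[OF basis_Ind(2)[OF assms(1)] basis_Ind(2)[OF assms(2)]])
    show "insert x {i \<in> c. i < j} \<notin> Ind" if "x \<in> {i \<in> b. i < j} - {i \<in> c. i < j}" for x
      using that assms(3,5) by (intro not_passive_lower) auto
  qed (use j in \<open>auto simp: passive_set_def\<close>)
  then show "j \<in> passive_set b" using \<open>j \<notin> X\<close> assms(3) by (auto simp: passive_set_def)
qed

text \<open>If no such \<open>i\<close> existed, every element of \<open>b\<close> below
  \<open>j\<close> would lie in the closure of the elements of \<open>c\<close> below
  \<open>j\<close>, and \<open>j\<close> would be passive for \<open>b\<close> too.\<close>

lemma passive_exchange:
  assumes "b \<in> bases" "c \<in> bases" "j \<in> passive_set c" "j \<notin> passive_set b"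
  shows "\<exists>i\<in>b \<inter> passive_set c. i \<le> j"
proof (cases "j \<in> b")
  case True
  then show ?thesis using assms(3) by auto
next
  case False
  show ?thesis
  proof (rule ccontr)
    assume *: "\<not> ?thesis"
    have "insert j {i \<in> b. i < j} \<in> Ind"
    proof (rule Ind_closure[OF basis_Ind(2)[OF assms(1)] basis_Ind(2)[OF assms(2)]])
      show "insert x {i \<in> c. i < j} \<notin> Ind" if "x \<in> {i \<in> b. i < j} - {i \<in> c. i < j}" for x
        using that * by (intro not_passive_lower) (auto intro: less_imp_le)
    qed (use assms(3) in \<open>auto simp: passive_set_def\<close>)
    then show False using False assms(4) by (simp add: passive_set_def)
  qed
qed

end

lemma matroidal_regular_decomposition:
  fixes I :: "('n::{finite,linorder}, 'k::field) mpoly set"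
  assumes "squarefree_matroidal_ideal I" and zero: "1 \<notin> I"
  shows "\<exists>st g. regular_decomposition I st g True"
proof -
  obtain Ind A where Ind: "matroid (UNIV :: 'n set) Ind"
      "keys ` min_gens I = matroid_bases Ind"
    and A: "\<forall>a\<in>A. \<forall>i. lookup a i \<le> 1" "I = ideal_gen (monom ` A)"
    using assms(1) unfolding squarefree_matroidal_ideal_def squarefree_monomial_ideal_def by blast
  interpret finite_matroid Ind by unfold_locales (rule Ind(1))
  let ?k = "keys :: ('n \<Rightarrow>\<^sub>0 nat) \<Rightarrow> 'n set"
  have sqfree: "lookup u i \<le> 1" if "u \<in> min_gens I" for u i
  proof -
    have "(monom u :: ('n, 'k) mpoly) \<in> I" using that by (simp add: min_gens_def)
    then obtain a y where a: "a \<in> A" "u = a + y" unfolding A(2) by (auto simp: ideal_gen_monom)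
    have "(monom a :: ('n, 'k) mpoly) \<in> I" using a(1) unfolding A(2) ideal_gen_monom
      by (auto intro!: exI[of _ 0])
    then have "a = u" using that a(2) by (auto simp: min_gens_def monom_dvd_monom)
    then show ?thesis using A(1) a(1) by auto
  qed
  have basis: "?k u \<in> bases" if "u \<in> min_gens I" for u using Ind(2) that by blast
  have eqI: "u = w" if "u \<in> min_gens I" "w \<in> min_gens I" "?k u = ?k w" for u w
  proof (rule poly_mapping_eqI)
    fix i
    have "i \<in> ?k u \<longleftrightarrow> i \<in> ?k w" by (simp only: that(3))
    then have "lookup u i = 0 \<longleftrightarrow> lookup w i = 0"
      unfolding in_keys_iff by blast
    then show "lookup u i = lookup w i"
      using sqfree[OF that(1), of i] sqfree[OF that(2), of i] by linarith
  qed
  \<comment> \<open>A basis is disjoint from its passive set, so the condition on the cofactor is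
    one on the support of the whole monomial, which takes the place of \<open>X\<close> in the
    greedy lemmas.\<close>
  have keys_disj: "?k (u + y) \<inter> passive_set (?k u) = {}" if "?k y \<inter> passive_set (?k u) = {}" for u y
    using that by (auto simp: passive_set_def)
  have "\<exists>g. regular_decomposition I (\<lambda>u. passive_set (?k u)) g True"
  proof (rule regular_decompositionI)
    show "monomial_ideal I" using A(2) by (auto simp: monomial_ideal_def)
    show "1 \<notin> I" by fact
    fix u assume u: "u \<in> min_gens I"
    show "\<exists>w\<in>min_gens I. \<exists>z. u + y = w + z \<and> ?k z \<inter> passive_set (?k w) = {}" for y
    proof -
      obtain c where c: "c \<in> bases" "c \<subseteq> ?k (u + y)" "?k (u + y) \<inter> passive_set c = {}"
        using greedy_exists[OF basis[OF u], of "?k (u + y)"] by auto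
      then obtain w where w: "w \<in> min_gens I" "c = ?k w" using Ind(2) by blast
      \<comment> \<open>A squarefree monomial divides every monomial whose support contains its
        own.\<close>
      have "lookup w j \<le> lookup (u + y) j" for j
      proof (cases "j \<in> ?k w")
        case True
        then have "j \<in> ?k (u + y)" using c(2) w(2) by blast
        then have "lookup (u + y) j \<noteq> 0" by (simp only: in_keys_iff not_False_eq_True)
        then show ?thesis using sqfree[OF w(1), of j] by linarith
      next
        case False
        then show ?thesis by (simp add: in_keys_iff)
      qed
      from poly_mapping_le_add[OF this] have eq: "u + y = w + (u + y - w)" .
      have "?k (u + y - w) \<subseteq> ?k (u + y)"
        using arg_cong[OF eq, of ?k] unfolding keys_add_nat by blast
      then have "?k (u + y - w) \<inter> passive_set (?k w) = {}" using c(3) unfolding w(2) by blast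
      with eq show ?thesis by (intro bexI[OF _ w(1)] exI[of _ "u + y - w"] conjI)
    qed
    fix w assume w: "w \<in> min_gens I"
    show "u = w" if eq: "u + y = w + z" and y: "?k y \<inter> passive_set (?k u) = {}"
      and z: "?k z \<inter> passive_set (?k w) = {}" for y z
    proof (rule eqI[OF u w], rule greedy_unique[OF basis[OF u] basis[OF w]])
      show "?k u \<subseteq> ?k (u + y)" "?k w \<subseteq> ?k (u + y)" by simp (simp add: eq del: keys_add_nat, simp)
      show "?k (u + y) \<inter> passive_set (?k u) = {}" by (rule keys_disj[OF y])
      show "?k (u + y) \<inter> passive_set (?k w) = {}" unfolding eq by (rule keys_disj[OF z])
    qed
    show "passive_set (?k w) \<subseteq> passive_set (?k u) \<and> (True \<longrightarrow> i \<notin> passive_set (?k w))"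
      if i: "i \<in> passive_set (?k u)" and eq: "u + xp i = w + z" and z: "?k z \<inter> passive_set (?k w) = {}" for i z
    proof -
      have d: "?k (u + xp i) \<inter> passive_set (?k w) = {}" unfolding eq by (rule keys_disj[OF z])
      have "?k w \<subseteq> ?k (u + xp i)" unfolding eq by simp
      with d have "passive_set (?k w) \<subseteq> passive_set (?k u)"
        by (intro greedy_passive_subset[OF basis[OF u] basis[OF w], of "?k (u + xp i)"]) auto
      then show ?thesis using d by auto
    qed
    show "\<exists>i\<in>?k u \<inter> passive_set (?k w). i \<le> j" if "j \<in> passive_set (?k w)" "j \<notin> passive_set (?k u)" for j
      by (rule passive_exchange[OF basis[OF u] basis[OF w] that])
  qed simp
  then show ?thesis by blast
qed

theorem theorem4:
  fixes I :: "('n::{finite,linorder}, 'k::field) mpoly set"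
    and scale :: "('n, 'k) mpoly \<Rightarrow> 'm::ab_group_add \<Rightarrow> 'm"
  assumes "squarefree_matroidal_ideal I \<or> stable_monomial_ideal I"
    and "minimal_free_resolution scale I B deg d e"
  shows "\<exists>\<mu>. dga_structure scale I B deg d e \<mu>"
proof -
  interpret minimal_free_resolution scale I B deg d e by fact
  have "\<exists>st g sep. regular_decomposition I st g sep"
    using assms(1)
  proof
    assume "squarefree_matroidal_ideal I"
    from matroidal_regular_decomposition[OF this one_notin_ideal] show ?thesis by blast
  next
    assume "stable_monomial_ideal I"
    from stable_regular_decomposition[OF this one_notin_ideal] show ?thesis by blast
  qed
  then obtain st g sep where rd: "regular_decomposition I st g sep" by blast
  interpret comparison scale I B deg d e st g sep
    by (intro comparison.intro assms(2) rd)
  show ?thesis using product_dga by blast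
qed

end
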